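(* Let $\alpha\in\mathbb{C}$ satisfy $7\alpha^3+7\alpha+1=0$. Define \begin{align*} P :=\;& x\left[x^{6}-3\cdot 7\cdot x^{4}y^{2}+5\cdot 7\cdot x^{2}y^{4}-7 y^{6}\right]\\ & + 7z\left[(x^2+y^2)^3-2^3 z^{2}(x^2+y^2)^2+2^4 z^{4}(x^{2}+y^{2})\right]-2^6 z^{7},\\ U_\alpha :=\;& (z+a_5 w)\left((z+w)(x^2+y^2)+a_1z^3+a_2z^2w+a_3zw^2+a_4w^3\right)^2, \end{align*} where \begin{align*} a_1 &:= -\tfrac{12}{7}\alpha^2-\tfrac{384}{49}\alpha-\tfrac{8}{7}, & a_2 &:= -\tfrac{32}{7}\alpha^2+\tfrac{24}{49}\alpha-4,\\ a_3 &:= -4\alpha^2+\tfrac{24}{49}\alpha-4, & a_4 &:= -\tfrac{8}{7}\alpha^2+\tfrac{8}{49}\alpha-\tfrac{8}{7},\\ a_5 &:= 49\alpha^2-7\alpha+50. \end{align*} Then the surface $S_\alpha$ of degree $7$ in $\mathbb{P}^3(\mathbb{C})$ (homogeneous coordinates $(x:y:z:w)$) defined by the equation $S_\alpha := P-U_\alpha = 0$ has exactly $99$ ordinary double points and no other singularities. Moreover, there is exactly one real solution $\alpha_{\mathbb{R}}\in\mathbb{R}$ of $7\alpha^3+7\alpha+1=0$, namely $\alpha_{\mathbb{R}}\approx -0.14010685$, and all the singularities of $S_{\alpha_{\mathbb{R}}}$ are also real.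
   Context: An ordinary double point (also called a node) of a surface is a singularity of type $A_1$, i.e. a singular point at which the Hessian of a local defining equation is nondegenerate. A singular point is real if it lies in $\mathbb{P}^3(\mathbb{R})\subset\mathbb{P}^3(\mathbb{C})$, i.e. it can be represented by real homogeneous coordinates. *)

theory Defs
  imports "HOL-Analysis.Analysis"
begin

section \<open>Complex projective 3-space\<close>

definition proj_rel :: "((complex^4) \<times> (complex^4)) set" where
  "proj_rel = {(v, w). v \<noteq> 0 \<and> w \<noteq> 0 \<and> (\<exists>c. w = c *s v)}"

definition P3 :: "(complex^4) set set" where
  "P3 = {v. v \<noteq> 0} // proj_rel"

definition real_point :: "(complex^4) set \<Rightarrow> bool" where
  "real_point p \<longleftrightarrow> p \<in> P3 \<and> (\<exists>v\<in>p. \<forall>i. v $ i \<in> \<real>)"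

lemma equiv_proj_rel: "equiv {v. v \<noteq> 0} proj_rel"
proof (rule equivI)
  show "proj_rel \<subseteq> {v. v \<noteq> 0} \<times> {v. v \<noteq> 0}"
    unfolding proj_rel_def by blast
  show "refl_on {v. v \<noteq> 0} proj_rel"
  proof (rule refl_onI)
    fix v :: "complex^4" assume "v \<in> {v. v \<noteq> 0}"
    moreover have "v = 1 *s v" by (rule vector_smult_lid[symmetric])
    ultimately show "(v, v) \<in> proj_rel" unfolding proj_rel_def by blast
  qed
  show "sym proj_rel"
  proof (rule symI)
    fix v w assume "(v, w) \<in> proj_rel"
    then obtain c where c: "v \<noteq> 0" "w \<noteq> 0" "w = c *s v" unfolding proj_rel_def by blast
    then have "c \<noteq> 0" by (metis vector_smult_lzero)
    then have "inverse c *s w = v"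
      by (simp only: c(3) vector_smult_assoc left_inverse vector_smult_lid not_False_eq_True)
    from c(1,2) this[symmetric] show "(w, v) \<in> proj_rel" unfolding proj_rel_def by blast
  qed
  show "trans proj_rel"
  proof (rule transI)
    fix u v w assume "(u, v) \<in> proj_rel" "(v, w) \<in> proj_rel"
    then obtain c d where "u \<noteq> 0" "w \<noteq> 0" "v = c *s u" "w = d *s v"
      unfolding proj_rel_def by blast
    moreover from this have "w = (d * c) *s u" by (simp only: vector_smult_assoc)
    ultimately show "(u, w) \<in> proj_rel" unfolding proj_rel_def by blast
  qed
qed


section \<open>Surfaces in projective 3-space\<close>

text \<open>Polynomials in several variables are represented by the functions they induce, which over
  the complex numbers determine them. The following says that \<open>F\<close> is a nonzero homogeneous
  polynomial of degree \<open>d\<close>; \<open>e\<close> ranges over the exponent vectors.\<close>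

definition homogeneous_form :: "nat \<Rightarrow> (complex^'n \<Rightarrow> complex) \<Rightarrow> bool" where
  "homogeneous_form d F \<longleftrightarrow>
     (\<exists>c :: ('n \<Rightarrow> nat) \<Rightarrow> complex.
        F = (\<lambda>v. \<Sum>e | (\<Sum>i\<in>UNIV. e i) = d. c e * (\<Prod>i\<in>UNIV. (v $ i) ^ e i)))
     \<and> (\<exists>v. F v \<noteq> 0)"

definition partial_deriv :: "'n \<Rightarrow> (complex^'n \<Rightarrow> complex) \<Rightarrow> complex^'n \<Rightarrow> complex" where
  "partial_deriv i F v = deriv (\<lambda>t. F (v + t *s axis i 1)) 0"

definition hessian :: "(complex^'n \<Rightarrow> complex) \<Rightarrow> complex^'n \<Rightarrow> complex^'n^'n" where
  "hessian F v = (\<chi> i j. partial_deriv i (partial_deriv j F) v)"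

text \<open>The parametrization of the affine chart \<open>v $ k \<noteq> 0\<close> normalized by \<open>v $ k = 1\<close>; hence
  \<open>F \<circ> affine_chart k\<close> is the dehomogenization of \<open>F\<close>, the local equation of \<open>F = 0\<close> there.\<close>

definition affine_chart :: "4 \<Rightarrow> complex^3 \<Rightarrow> complex^4" where
  "affine_chart k u =
     (if k = 1 then vector [1, u $ 1, u $ 2, u $ 3]
      else if k = 2 then vector [u $ 1, 1, u $ 2, u $ 3]
      else if k = 3 then vector [u $ 1, u $ 2, 1, u $ 3]
      else vector [u $ 1, u $ 2, u $ 3, 1])"

lemma vector_4_nth [simp]:
  "(vector [a, b, c, d] :: 'a::zero^4) $ 1 = a"
  "(vector [a, b, c, d] :: 'a::zero^4) $ 2 = b"
  "(vector [a, b, c, d] :: 'a::zero^4) $ 3 = c"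
  "(vector [a, b, c, d] :: 'a::zero^4) $ 4 = d"
  unfolding vector_def by simp_all

lemma affine_chart_nth [simp]: "affine_chart k u $ k = 1"
  using exhaust_4[of k] by (auto simp: affine_chart_def)

text \<open>For homogeneous \<open>F\<close> the condition does not depend on the chosen representative.\<close>

definition singular_point :: "(complex^4 \<Rightarrow> complex) \<Rightarrow> (complex^4) set \<Rightarrow> bool" where
  "singular_point F p \<longleftrightarrow> p \<in> P3 \<and> (\<exists>v\<in>p. F v = 0 \<and> (\<forall>i. partial_deriv i F v = 0))"

definition ordinary_double_point :: "(complex^4 \<Rightarrow> complex) \<Rightarrow> (complex^4) set \<Rightarrow> bool" where
  "ordinary_double_point F p \<longleftrightarrow> singular_point F p \<and>
     (\<exists>k u. affine_chart k u \<in> p \<and> det (hessian (F \<circ> affine_chart k) u) \<noteq> 0)"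


section \<open>The family of septics\<close>

definition P :: "complex \<Rightarrow> complex \<Rightarrow> complex \<Rightarrow> complex" where
  "P x y z =
     x * (x^6 - 3 * 7 * x^4 * y^2 + 5 * 7 * x^2 * y^4 - 7 * y^6)
     + 7 * z * ((x^2 + y^2)^3 - 2^3 * z^2 * (x^2 + y^2)^2 + 2^4 * z^4 * (x^2 + y^2))
     - 2^6 * z^7"

definition a1 :: "complex \<Rightarrow> complex" where
  "a1 \<alpha> = - (12/7) * \<alpha>^2 - (384/49) * \<alpha> - 8/7"

definition a2 :: "complex \<Rightarrow> complex" where
  "a2 \<alpha> = - (32/7) * \<alpha>^2 + (24/49) * \<alpha> - 4"

definition a3 :: "complex \<Rightarrow> complex" where
  "a3 \<alpha> = - 4 * \<alpha>^2 + (24/49) * \<alpha> - 4"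

definition a4 :: "complex \<Rightarrow> complex" where
  "a4 \<alpha> = - (8/7) * \<alpha>^2 + (8/49) * \<alpha> - 8/7"

definition a5 :: "complex \<Rightarrow> complex" where
  "a5 \<alpha> = 49 * \<alpha>^2 - 7 * \<alpha> + 50"

definition U :: "complex \<Rightarrow> complex \<Rightarrow> complex \<Rightarrow> complex \<Rightarrow> complex \<Rightarrow> complex" where
  "U \<alpha> x y z w =
     (z + a5 \<alpha> * w)
     * ((z + w) * (x^2 + y^2) + a1 \<alpha> * z^3 + a2 \<alpha> * z^2 * w + a3 \<alpha> * z * w^2 + a4 \<alpha> * w^3)^2"

definition S :: "complex \<Rightarrow> complex^4 \<Rightarrow> complex" where
  "S \<alpha> v = P (v $ 1) (v $ 2) (v $ 3) - U \<alpha> (v $ 1) (v $ 2) (v $ 3) (v $ 4)"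

end

theory Submission
  imports Defs
begin

text \<open>
  Substitute \<open>w = 7 * \<alpha> * t - z\<close>, that is, \<open>t = (z + w) / (7 * \<alpha>)\<close>. Then \<open>S \<alpha>\<close> turns into one and the
  same form with integer coefficients for all three roots \<open>\<alpha>\<close> (lemma \<open>S_eq_septic\<close>),
    \<open>P x y z + (z + t) * (7 * t * \<rho> - 8 * z^3 + 4 * z\<^sup>2 * t + 4 * z * t\<^sup>2 - 8 * t^3)\<^sup>2\<close>
  with \<open>\<rho> = x\<^sup>2 + y\<^sup>2\<close>. The singularities are therefore those of one rational surface, and \<open>\<alpha>\<close> returns
  only when points are carried back to the coordinate \<open>w\<close>; a real \<open>\<alpha>\<close> carries real points to real
  points.

  The form is invariant under rotations of order seven about the axis \<open>x = y = 0\<close>. In the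
  coordinates \<open>u = x + \<i> * y\<close>, \<open>v = x - \<i> * y\<close> it is \<open>(u^7 + v^7) / 2\<close> plus a function of
  \<open>(u * v, z, t)\<close>; at a singular point this forces \<open>u^7 = v^7\<close>, so every singular point is a
  rotation of one in the plane \<open>y = 0\<close> (\<open>affine_nodes_eq\<close>). There the surface cuts out the plane
  septic \<open>(x - z) * q\<^sup>2 + (z + t) * C\<^sup>2 = 0\<close>, where \<open>q\<close> is a product of three lines and \<open>C\<close> is the cubic
  above. It is singular at the nine points \<open>q = C = 0\<close>. Elimination yields the remaining
  singular points: five off the axis (\<open>plane_singular_imp_node\<close>) and one on it (\<open>axis_node\<close>). All
  lie off the plane \<open>z = 0\<close>. The fourteen points off the axis have seven rotations each, and
  \<open>14 * 7 + 1 = 99\<close> (\<open>card_affine_nodes\<close>).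

  The coordinates \<open>x\<close> of the fourteen points, at \<open>z = 1\<close>, are roots of two cubics and a quadratic with only
  real roots, and \<open>t\<close> is a polynomial in \<open>x\<close> with rational coefficients; this gives both the
  count and the reality. Finally, the Hessian determinant depends only on the rotation
  invariants \<open>\<rho>\<close>, \<open>u^7 + v^7\<close>, \<open>t\<close>, so it suffices to see that it does not vanish at the fifteen
  plane points (\<open>plane_node_nondegenerate\<close>).
\<close>

section \<open>A rational model of the septics\<close>

text \<open>In the coordinate \<open>t = (z + w) / (7 * \<alpha>)\<close> the cubic under the square in \<open>U \<alpha>\<close> is \<open>\<alpha>\<close> times the
  following cubic with integer coefficients, for all three roots \<open>\<alpha>\<close>. Here \<open>\<rho>\<close> stands for
  \<open>x\<^sup>2 + y\<^sup>2\<close>; the suffixes \<open>_t\<close>, \<open>_x\<close>, \<open>_\<rho>\<close> below denote partial derivatives.\<close>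

definition cubic :: "complex \<Rightarrow> complex \<Rightarrow> complex \<Rightarrow> complex" where
  "cubic \<rho> z t = 7*t*\<rho> - 8*z^3 + 4*z^2*t + 4*z*t^2 - 8*t^3"

definition cubic_t :: "complex \<Rightarrow> complex \<Rightarrow> complex \<Rightarrow> complex" where
  "cubic_t \<rho> z t = 7*\<rho> + 4*z^2 + 8*z*t - 24*t^2"

definition septic :: "complex \<Rightarrow> complex \<Rightarrow> complex \<Rightarrow> complex \<Rightarrow> complex" where
  "septic x y z t = P x y z + (z + t) * (cubic (x^2 + y^2) z t)^2"

text \<open>The septic is \<open>Re ((x + \<i> * y)^7)\<close> plus a function of \<open>(\<rho>, z, t)\<close>, which is invariant under rotations
  about the axis \<open>x = y = 0\<close>. This is the \<open>\<rho>\<close>-derivative of that invariant part.\<close>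

definition septic_\<rho> :: "complex \<Rightarrow> complex \<Rightarrow> complex \<Rightarrow> complex" where
  "septic_\<rho> \<rho> z t = 7*z*(3*\<rho>^2 - 16*z^2*\<rho> + 16*z^4) + 14*t*(z + t)*cubic \<rho> z t"

definition septic_x :: "complex \<Rightarrow> complex \<Rightarrow> complex \<Rightarrow> complex \<Rightarrow> complex" where
  "septic_x x y z t = 7*x^6 - 105*x^4*y^2 + 105*x^2*y^4 - 7*y^6 + 2*x * septic_\<rho> (x^2+y^2) z t"

definition septic_y :: "complex \<Rightarrow> complex \<Rightarrow> complex \<Rightarrow> complex \<Rightarrow> complex" where
  "septic_y x y z t = - 42*x^5*y + 140*x^3*y^3 - 42*x*y^5 + 2*y * septic_\<rho> (x^2+y^2) z t"

definition septic_t :: "complex \<Rightarrow> complex \<Rightarrow> complex \<Rightarrow> complex \<Rightarrow> complex" where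
  "septic_t x y z t = cubic (x^2+y^2) z t * (cubic (x^2+y^2) z t + 2*(z + t)*cubic_t (x^2+y^2) z t)"

definition septic_z :: "complex \<Rightarrow> complex \<Rightarrow> complex \<Rightarrow> complex \<Rightarrow> complex" where
  "septic_z x y z t = 7*((x^2+y^2)^3 - 24*z^2*(x^2+y^2)^2 + 80*z^4*(x^2+y^2)) - 448*z^6
     + cubic (x^2+y^2) z t * (cubic (x^2+y^2) z t + 2*(z + t)*(- 24*z^2 + 8*z*t + 4*t^2))"

lemma root_nonzero:
  fixes \<alpha> :: complex
  assumes "7 * \<alpha>^3 + 7 * \<alpha> + 1 = 0"
  shows "\<alpha> \<noteq> 0"
  using assms by auto

text \<open>The root \<open>\<alpha>\<close> enters \<open>S \<alpha>\<close> only through the choice of coordinates. Under \<open>w = 7 * \<alpha> * t - z\<close>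
  the linear factor of \<open>U \<alpha>\<close> becomes \<open>- (z + t) / \<alpha>\<^sup>2\<close> and the cubic becomes \<open>\<alpha>\<close> times a rational
  cubic, so that all powers of \<open>\<alpha>\<close> cancel.\<close>

lemma S_eq_septic:
  assumes \<alpha>: "7 * \<alpha>^3 + 7 * \<alpha> + 1 = 0"
  shows "S \<alpha> v = septic (v$1) (v$2) (v$3) ((v$3 + v$4) / (7*\<alpha>))"
proof -
  define x y z w t where defs: "x = v$1" "y = v$2" "z = v$3" "w = v$4" "t = (v$3 + v$4) / (7*\<alpha>)"
  have w: "w = 7*\<alpha>*t - z"
    using root_nonzero[OF \<alpha>] by (simp add: defs)
  have "\<alpha>^2 * (z + a5 \<alpha> * w) = - (z + t)"
    using \<alpha> unfolding a5_def w by algebra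
  moreover have "49 * ((z + w)*(x^2+y^2) + a1 \<alpha> * z^3 + a2 \<alpha> * z^2*w + a3 \<alpha> * z*w^2 + a4 \<alpha> * w^3)
      = 49 * (\<alpha> * cubic (x^2+y^2) z t)"
    using \<alpha> unfolding a1_def a2_def a3_def a4_def w cubic_def
    by (simp add: field_simps) algebra
  hence "(z + w)*(x^2+y^2) + a1 \<alpha> * z^3 + a2 \<alpha> * z^2*w + a3 \<alpha> * z*w^2 + a4 \<alpha> * w^3
      = \<alpha> * cubic (x^2+y^2) z t" by (simp only: mult_cancel_left) simp
  ultimately have "U \<alpha> x y z w = - ((z + t) * (cubic (x^2+y^2) z t)^2)"
    unfolding U_def by algebra
  thus ?thesis
    by (simp add: S_def septic_def defs)
qed

lemma septic_Euler:
  "x * septic_x x y z t + y * septic_y x y z t + z * septic_z x y z t + t * septic_t x y z t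
     = 7 * septic x y z t"
  unfolding septic_x_def septic_y_def septic_z_def septic_t_def septic_def septic_\<rho>_def P_def
    cubic_def cubic_t_def by algebra

lemma septic_partials_homogeneous:
  "septic_x (c*x) (c*y) (c*z) (c*t) = c^6 * septic_x x y z t"
  "septic_y (c*x) (c*y) (c*z) (c*t) = c^6 * septic_y x y z t"
  "septic_z (c*x) (c*y) (c*z) (c*t) = c^6 * septic_z x y z t"
  "septic_t (c*x) (c*y) (c*z) (c*t) = c^6 * septic_t x y z t"
  unfolding septic_x_def septic_y_def septic_z_def septic_t_def septic_\<rho>_def
    cubic_def cubic_t_def by algebra+

text \<open>The last two coordinates are \<open>z\<close> and \<open>w\<close> with \<open>t = (z + w) * k\<close>, because the definition of a
  singular point differentiates with respect to \<open>w\<close>.\<close>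

lemma septic_DERIV:
  "((\<lambda>x. septic x y z t) has_field_derivative septic_x x y z t) (at x)"
  "((\<lambda>y. septic x y z t) has_field_derivative septic_y x y z t) (at y)"
  "((\<lambda>z. septic x y z ((z + w) * k)) has_field_derivative
      septic_z x y z ((z + w)*k) + k * septic_t x y z ((z + w)*k)) (at z)"
  "((\<lambda>w. septic x y z ((z + w) * k)) has_field_derivative
      k * septic_t x y z ((z + w)*k)) (at w)"
  unfolding septic_x_def septic_y_def septic_z_def septic_t_def septic_def septic_\<rho>_def P_def
    cubic_def cubic_t_def
  subgoal by (auto intro!: derivative_eq_intros) algebra
  subgoal by (auto intro!: derivative_eq_intros) algebra
  subgoal by (auto intro!: derivative_eq_intros) algebra
  subgoal by (auto intro!: derivative_eq_intros) algebra
  done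

section \<open>Singular points of the plane curve\<close>

text \<open>In the plane \<open>y = 0\<close> the seven planes \<open>P = 0\<close> become the line \<open>x = z\<close> and three double
  lines, since the reflection \<open>y \<mapsto> - y\<close> swaps the other six in pairs. This cubic in the affine
  coordinate \<open>x / z\<close> is the product of the three double lines.\<close>

definition double_lines :: "complex \<Rightarrow> complex" where
  "double_lines x = x^3 + 4*x^2 - 4*x - 8"

text \<open>The \<open>(x, t)\<close>-coordinates, at \<open>z = 1\<close>, of the fourteen nodes off the axis \<open>x = 0\<close> of the plane curve
  \<open>y = 0\<close>: nine on the double lines, then three conjugate ones, then two that lie on the line
  \<open>t = - x\<close>, which is a component of the curve.\<close>

definition plane_nodes :: "(complex \<times> complex) set" where
  "plane_nodes = {(x, t).
      double_lines x = 0 \<and> (t = - x \<or> t = 1 - x^2/4 \<or> t = x^2/4 + x - 1/2)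
    \<or> x^3 - 2*x^2 - 8*x + 8 = 0 \<and> t = 1 - x^2/4
    \<or> 5*x^2 - 2*x - 4 = 0 \<and> t = - x}"

lemma cubic_at_1:
  "cubic \<rho> 1 t = 7*t*\<rho> - 8 + 4*t + 4*t^2 - 8*t^3"
  "cubic_t \<rho> 1 t = 7*\<rho> + 4 + 8*t - 24*t^2"
  by (simp_all add: cubic_def cubic_t_def)

lemma plane_septic:
  "septic x 0 1 t = (x - 1) * (double_lines x)^2 + (1 + t) * (cubic (x^2) 1 t)^2"
  unfolding septic_def P_def double_lines_def by simp algebra

lemma plane_septic_x:
  "septic_x x 0 1 t = 7*x*((x^2 + 2*x - 4) * double_lines x + 4*t*(1 + t) * cubic (x^2) 1 t)"
  unfolding septic_x_def septic_\<rho>_def double_lines_def by simp algebra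

lemma clear_denominators:
  fixes x t :: complex
  shows "t = 1 - x^2/4 \<longleftrightarrow> 4*t = 4 - x^2" "t = x^2/4 + x - 1/2 \<longleftrightarrow> 4*t = x^2 + 4*x - 2"
  by (simp_all add: field_simps) algebra+

text \<open>Restricted to a double line, where \<open>x\<close> is a root of \<open>double_lines\<close>, the cubic splits into three
  linear factors in \<open>t\<close> over the field generated by \<open>x\<close>. This yields nine of the nodes.\<close>

lemma cubic_factors:
  assumes "double_lines x = 0"
  shows "cubic (x^2) 1 t = 0 \<longleftrightarrow> t = - x \<or> t = 1 - x^2/4 \<or> t = x^2/4 + x - 1/2"
proof -
  have "2 * cubic (x^2) 1 t = - (t + x) * (4*t - (4 - x^2)) * (4*t - (x^2 + 4*x - 2))"
    using assms unfolding cubic_at_1 double_lines_def by algebra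
  hence "cubic (x^2) 1 t = 0 \<longleftrightarrow>
      - (t + x) * (4*t - (4 - x^2)) * (4*t - (x^2 + 4*x - 2)) = 0" by auto
  thus ?thesis
    by (simp only: mult_eq_0_iff neg_equal_0_iff_equal disj_assoc clear_denominators
        right_minus_eq eq_neg_iff_add_eq_0)
qed

text \<open>The hypotheses are the equations that hold at the singular points away from the double lines.
  They have five common solutions; two lie on the line \<open>t = - x\<close> and three on the conic
  \<open>4 * t = 4 - x\<^sup>2\<close>, so the product of the two equations vanishes there; it even lies
  in the ideal that the hypotheses generate.\<close>

lemma residual_nodes_on_curves:
  fixes x t :: complex
  assumes e1: "8*t^3 + 4*t^2 - 4*t - 3*x^2*t - 2*x^2 = 0"
    and e2: "(x^2+2*x-4)^2 + (x-1)*(8*t^2 + (8+6*x^2)*t + 4*x^2) = 0"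
    and e3: "(x^2+2*x-4)*(x^3+4*x^2-4*x-8) + (12*x^2-24)*t^2 + (6*x^4+14*x^2-24)*t + 4*x^4 + 4*x^2 = 0"
  shows "(t + x) * (4*t + x^2 - 4) = 0"
proof -
  \<comment> \<open>The cofactors solve a linear system: ideal membership with bounded degrees.\<close>
  have "48 * ((t + x) * (4*t + x^2 - 4)) =
      (280 + 432*x - 144*x^2 - 136*x^3 - 15*x^4 + (168 + 236*x - 66*x^2 - 50*x^3)*t)
        * (8*t^3 + 4*t^2 - 4*t - 3*x^2*t - 2*x^2)
    + (24 - 124*x - 106*x^2 - 4*x^3 - (236 + 420*x + 211*x^2)*t - (108 + 172*x + 100*x^2)*t^2)
        * ((x^2+2*x-4)^2 + (x-1)*(8*t^2 + (8+6*x^2)*t + 4*x^2))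
    + (- 12 + 68*x + 4*x^2 + (144 + 166*x)*t + (92 + 100*x)*t^2)
        * ((x^2+2*x-4)*(x^3+4*x^2-4*x-8) + (12*x^2-24)*t^2 + (6*x^4+14*x^2-24)*t + 4*x^4 + 4*x^2)"
    by algebra
  also have "\<dots> = 0" unfolding e1 e2 e3 by simp
  finally show ?thesis by simp
qed

lemma plane_nodes_nonzero:
  assumes "(x, t) \<in> plane_nodes" shows "x \<noteq> 0"
  using assms by (auto simp: plane_nodes_def double_lines_def)

text \<open>The curve has the form \<open>(x - 1) * q\<^sup>2 + (1 + t) * C\<^sup>2 = 0\<close>. If \<open>q\<close> vanishes at a singular point then
  so does \<open>C\<close>, which gives the nodes on the double lines. Otherwise both are nonzero, the \<open>t\<close>-derivative loses a
  factor \<open>C\<close>, and squaring the \<open>x\<close>-derivative and dividing by \<open>q\<^sup>2\<close> with the help of the equation of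
  the curve leaves equations of low degree.\<close>

lemma plane_singular_imp_node:
  assumes "x \<noteq> 0" "septic x 0 1 t = 0" "septic_x x 0 1 t = 0" "septic_t x 0 1 t = 0"
  shows "(x, t) \<in> plane_nodes"
proof -
  define q C where "q = double_lines x" and "C = cubic (x^2) 1 t"
  have f: "(x - 1) * q^2 + (1 + t) * C^2 = 0"
    using assms(2) by (simp add: plane_septic q_def C_def)
  have fx: "(x^2 + 2*x - 4) * q + 4*t*(1 + t) * C = 0"
    using assms(1,3) by (simp add: plane_septic_x q_def C_def)
  have ft: "C * (C + 2*(1 + t)*cubic_t (x^2) 1 t) = 0"
    using assms(4) by (simp add: septic_t_def C_def)
  show ?thesis
  proof (cases "q = 0")
    case True
    hence "(1 + t) * C^2 = 0" using f by simp
    hence "C = 0" using ft by (auto simp: add_eq_0_iff)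
    thus ?thesis
      using cubic_factors[of x t] True by (auto simp: plane_nodes_def q_def C_def)
  next
    case False
    have "C \<noteq> 0"
    proof
      assume "C = 0"
      hence "x = 1" "x^2 + 2*x - 4 = 0" using f fx False by auto
      thus False by simp
    qed
    hence ct: "C + 2*(1 + t)*cubic_t (x^2) 1 t = 0" using ft by simp
    have C: "C = 7*t*x^2 - 8 + 4*t + 4*t^2 - 8*t^3" by (simp add: C_def cubic_at_1)
    have "7 * (8*t^3 + 4*t^2 - 4*t - 3*x^2*t - 2*x^2) = 0"
      using ct unfolding C cubic_at_1 by algebra
    hence e1: "8*t^3 + 4*t^2 - 4*t - 3*x^2*t - 2*x^2 = 0"
      by (simp only: mult_eq_0_iff) simp
    \<comment> \<open>Square \<open>fx\<close> and use \<open>f\<close> to replace \<open>(1 + t) * C\<^sup>2\<close> by \<open>(1 - x) * q\<^sup>2\<close>.\<close>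
    have "((x^2+2*x-4)^2 + 16*t^2*(1+t)*(x-1)) * q^2 = 0"
      using f fx by algebra
    hence "(x^2+2*x-4)^2 + 16*t^2*(1+t)*(x-1) = 0" using False by simp
    hence e2: "(x^2+2*x-4)^2 + (x-1)*(8*t^2 + (8+6*x^2)*t + 4*x^2) = 0"
      using e1 by algebra
    have e3: "(x^2+2*x-4)*(x^3+4*x^2-4*x-8) + (12*x^2-24)*t^2 + (6*x^4+14*x^2-24)*t + 4*x^4 + 4*x^2 = 0"
      using fx e1 unfolding C q_def double_lines_def by algebra
    have "t + x = 0 \<or> 4*t + x^2 - 4 = 0"
      using residual_nodes_on_curves[OF e1 e2 e3] by (simp only: mult_eq_0_iff)
    then consider "t = - x" | "4*t = 4 - x^2"
      by (auto simp: eq_neg_iff_add_eq_0 algebra_simps)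
    thus ?thesis
    proof cases
      case 1
      \<comment> \<open>On the line \<open>e1\<close> is already a multiple of the quadratic polynomial.\<close>
      have "x * (5*x^2 - 2*x - 4) = 0" using e1 unfolding 1 by algebra
      thus ?thesis using 1 assms(1) by (simp add: plane_nodes_def)
    next
      case 2
      \<comment> \<open>On the conic \<open>e1\<close> has six zeros in \<open>x\<close>, symmetric about 0; \<open>e2\<close> keeps three of them.\<close>
      have "x^2 * (x^3 - 2*x^2 - 8*x + 8) = 0" using e2 2 by algebra
      hence "x^3 - 2*x^2 - 8*x + 8 = 0" using assms(1) by (simp only: mult_eq_0_iff) simp
      moreover have "t = 1 - x^2/4" using 2 by (simp add: field_simps)
      ultimately show ?thesis by (simp add: plane_nodes_def)
    qed
  qed
qed

lemma plane_node_imp_singular: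
  assumes "(x, t) \<in> plane_nodes"
  shows "septic x 0 1 t = 0" "septic_x x 0 1 t = 0" "septic_t x 0 1 t = 0"
proof -
  consider (base) "double_lines x = 0" "cubic (x^2) 1 t = 0"
    | (cubic) "x^3 - 2*x^2 - 8*x + 8 = 0" "4*t = 4 - x^2"
    | (quad) "5*x^2 - 2*x - 4 = 0" "t = - x"
    using assms cubic_factors[of x t] by (auto simp: plane_nodes_def)
  note cs = this
  note unf = plane_septic plane_septic_x septic_t_def cubic_at_1 double_lines_def
  show "septic x 0 1 t = 0"
    using cs
  proof cases
    case base thus ?thesis by (simp add: plane_septic)
  next
    case cubic thus ?thesis unfolding unf by algebra
  next
    case quad thus ?thesis unfolding unf by algebra
  qed
  show "septic_x x 0 1 t = 0"
    using cs
  proof cases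
    case base thus ?thesis by (simp add: plane_septic_x)
  next
    case cubic thus ?thesis unfolding unf by algebra
  next
    case quad thus ?thesis unfolding unf by algebra
  qed
  show "septic_t x 0 1 t = 0"
    using cs
  proof cases
    case base thus ?thesis by (simp add: septic_t_def)
  next
    case cubic
    have "2 * (cubic (x^2) 1 t + 2*(1 + t)*cubic_t (x^2) 1 t) = 0"
      using cubic unfolding unf by algebra
    hence "cubic (x^2) 1 t + 2*(1 + t)*cubic_t (x^2) 1 t = 0"
      by (simp only: mult_eq_0_iff) simp
    thus ?thesis by (simp add: septic_t_def)
  next
    case quad
    have "cubic (x^2) 1 t + 2*(1 + t)*cubic_t (x^2) 1 t = 0"
      using quad unfolding unf by algebra
    thus ?thesis by (simp add: septic_t_def)
  qed
qed

section \<open>The rotation symmetry\<close>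

text \<open>The equation of the surface stands in for the \<open>z\<close>-derivative: at \<open>z = 1\<close> Euler's relation
  expresses each through the other and the remaining derivatives.\<close>

definition affine_nodes :: "(complex \<times> complex \<times> complex) set" where
  "affine_nodes = {(x, y, t). septic x y 1 t = 0 \<and> septic_x x y 1 t = 0 \<and>
      septic_y x y 1 t = 0 \<and> septic_t x y 1 t = 0}"

text \<open>Multiplication of \<open>x + \<i> * y\<close> by \<open>\<omega>\<close> and of \<open>x - \<i> * y\<close> by \<open>inverse \<omega>\<close>, applied to a point
  \<open>(r, 0, t)\<close>; for \<open>\<omega>\<close> on the unit circle this is a real rotation.\<close>

definition rotate :: "complex \<Rightarrow> complex \<times> complex \<Rightarrow> complex \<times> complex \<times> complex" where
  "rotate \<omega> = (\<lambda>(r, t). (r * (\<omega> + inverse \<omega>) / 2, r * (\<omega> - inverse \<omega>) / (2 * \<i>), t))"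

text \<open>In the coordinates \<open>x + \<i> * y\<close> and \<open>x - \<i> * y\<close> the seven-fold symmetry is diagonal, and the
  part of the septic that is not rotation invariant is a sum of two seventh powers.\<close>

lemma isotropic_coordinates:
  fixes x y :: complex
  defines "u \<equiv> x + \<i> * y" and "v \<equiv> x - \<i> * y"
  shows "x^2 + y^2 = u * v"
    and "septic x y z t = (u^7 + v^7)/2 + 7*z*((u * v)^3 - 8*z^2*(u * v)^2 + 16*z^4*(u * v)) - 64*z^7
           + (z + t) * (cubic (u * v) z t)^2"
    and "septic_x x y z t - \<i> * septic_y x y z t = 7*u^6 + 2 * v * septic_\<rho> (u * v) z t"
    and "septic_x x y z t + \<i> * septic_y x y z t = 7 * v^6 + 2*u * septic_\<rho> (u * v) z t"
proof -
  have i: "\<i>^2 = -1" by simp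
  show \<rho>: "x^2 + y^2 = u * v"
    using i unfolding u_def v_def by algebra
  have "(u^7 + v^7)/2 = x^7 - 21*x^5*y^2 + 35*x^3*y^4 - 7*x*y^6"
    using i unfolding u_def v_def by algebra
  thus "septic x y z t = (u^7 + v^7)/2 + 7*z*((u * v)^3 - 8*z^2*(u * v)^2 + 16*z^4*(u * v)) - 64*z^7
           + (z + t) * (cubic (u * v) z t)^2"
    unfolding septic_def P_def \<rho> by algebra
  have "u^6 = (x^6 - 15*x^4*y^2 + 15*x^2*y^4 - y^6) + \<i> * (6*x^5*y - 20*x^3*y^3 + 6*x*y^5)"
    "v^6 = (x^6 - 15*x^4*y^2 + 15*x^2*y^4 - y^6) - \<i> * (6*x^5*y - 20*x^3*y^3 + 6*x*y^5)"
    using i unfolding u_def v_def by algebra+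
  thus "septic_x x y z t - \<i> * septic_y x y z t = 7*u^6 + 2 * v * septic_\<rho> (u * v) z t"
    "septic_x x y z t + \<i> * septic_y x y z t = 7 * v^6 + 2*u * septic_\<rho> (u * v) z t"
    unfolding septic_x_def septic_y_def \<rho> u_def v_def by algebra+
qed

lemma septic_t_cong:
  assumes "x^2 + y^2 = x'^2 + y'^2"
  shows "septic_t x y z t = septic_t x' y' z t"
  by (simp add: septic_t_def assms)

lemma rotate_coordinates:
  assumes "rotate \<omega> (r, t) = (x, y, t')"
  shows "x + \<i> * y = r * \<omega>" "x - \<i> * y = r * inverse \<omega>" "t' = t"
proof -
  have x: "x = r * (\<omega> + inverse \<omega>) / 2" and y: "y = r * (\<omega> - inverse \<omega>) / (2 * \<i>)" and "t' = t"
    using assms by (simp_all add: rotate_def)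
  have iy: "\<i> * y = r * (\<omega> - inverse \<omega>) / 2" by (simp add: y)
  have halves: "r * (a + b) / 2 + r * (a - b) / 2 = r * a" "r * (a + b) / 2 - r * (a - b) / 2 = r * b"
    for a b :: complex by (simp_all add: field_simps)
  show "x + \<i> * y = r * \<omega>" "x - \<i> * y = r * inverse \<omega>"
    unfolding iy x by (rule halves)+
  show "t' = t" by fact
qed

lemma seventh_root_inverse:
  fixes \<omega> :: complex
  assumes "\<omega>^7 = 1"
  shows "\<omega> \<noteq> 0" "\<omega>^6 = inverse \<omega>" "(inverse \<omega>)^6 = \<omega>"
proof -
  show "\<omega> \<noteq> 0" using assms by auto
  moreover have "\<omega>^6 * \<omega> = 1" using assms by (simp flip: power_Suc2)
  ultimately show "\<omega>^6 = inverse \<omega>" by (simp add: field_simps)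
  thus "(inverse \<omega>)^6 = \<omega>" by (metis inverse_inverse_eq power_inverse)
qed

lemma rotate_singular_iff:
  assumes \<omega>: "\<omega>^7 = 1" and r: "rotate \<omega> (r, t) = (x, y, t')"
  shows "septic x y z t = septic r 0 z t"
    and "septic_t x y z t = septic_t r 0 z t"
    and "septic_x x y z t = 0 \<and> septic_y x y z t = 0 \<longleftrightarrow> septic_x r 0 z t = 0"
proof -
  define u v where uv: "u = x + \<i> * y" "v = x - \<i> * y"
  note w = seventh_root_inverse[OF \<omega>]
  have u: "u = r * \<omega>" and v: "v = r * inverse \<omega>"
    using rotate_coordinates[OF r] uv by auto
  have \<rho>: "u * v = r^2" and u7: "u^7 = r^7" and v7: "v^7 = r^7"
    using \<omega> w(1) unfolding u v by (simp_all add: power2_eq_square power_mult_distrib power_inverse)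
  have u6: "u^6 = r^6 * inverse \<omega>" and v6: "v^6 = r^6 * \<omega>"
    using w unfolding u v by (simp_all add: power_mult_distrib)
  show "septic x y z t = septic r 0 z t"
    using isotropic_coordinates(2)[of x y z t] isotropic_coordinates(2)[of r 0 z t]
    by (simp add: uv[symmetric] \<rho> u7 v7 flip: power2_eq_square)
  show "septic_t x y z t = septic_t r 0 z t"
    using isotropic_coordinates(1)[of x y] \<rho> by (intro septic_t_cong) (simp add: uv)
  have sx: "septic_x r 0 z t = 7*r^6 + 2*r * septic_\<rho> (r^2) z t"
    by (simp add: septic_x_def)
  have 1: "septic_x x y z t - \<i> * septic_y x y z t = inverse \<omega> * septic_x r 0 z t"
    using isotropic_coordinates(3)[of x y z t]
    unfolding uv[symmetric] \<rho> sx u6 unfolding v by (simp add: algebra_simps)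
  have 2: "septic_x x y z t + \<i> * septic_y x y z t = \<omega> * septic_x r 0 z t"
    using isotropic_coordinates(4)[of x y z t]
    unfolding uv[symmetric] \<rho> sx v6 unfolding u by (simp add: algebra_simps)
  show "septic_x x y z t = 0 \<and> septic_y x y z t = 0 \<longleftrightarrow> septic_x r 0 z t = 0"
  proof
    assume "septic_x x y z t = 0 \<and> septic_y x y z t = 0"
    thus "septic_x r 0 z t = 0" using 2 w by simp
  next
    assume "septic_x r 0 z t = 0"
    with 1 2 have e: "septic_x x y z t - \<i> * septic_y x y z t = 0"
      "septic_x x y z t + \<i> * septic_y x y z t = 0" by simp_all
    have "2 * septic_x x y z t = (septic_x x y z t - \<i> * septic_y x y z t) + (septic_x x y z t + \<i> * septic_y x y z t)"
      by simp
    also have "\<dots> = 0" unfolding e by simp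
    finally show "septic_x x y z t = 0 \<and> septic_y x y z t = 0" using e by auto
  qed
qed

text \<open>The two derivative conditions say \<open>7 * u^6 = - 2 * v * g\<close> and \<open>7 * v^6 = - 2 * u * g\<close>, hence
  \<open>u^7 = v^7\<close>. The seventh root of unity \<open>u / v\<close> has a unique square root that is again a
  seventh root of unity, and undoing its rotation makes \<open>u\<close> and \<open>v\<close> equal, that is, \<open>y = 0\<close>.\<close>

lemma singular_off_axis_rotation:
  assumes "septic_x x y z t = 0" "septic_y x y z t = 0" "x^2 + y^2 \<noteq> 0"
  obtains \<omega> r where "\<omega>^7 = 1" "r \<noteq> 0" "(x, y, t) = rotate \<omega> (r, t)"
proof -
  define u v where uv: "u = x + \<i> * y" "v = x - \<i> * y"
  have \<rho>: "x^2 + y^2 = u * v" using isotropic_coordinates(1)[of x y] by (simp add: uv)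
  have nz: "u \<noteq> 0" "v \<noteq> 0" using assms(3) unfolding \<rho> by auto
  have "7*u^6 + 2 * v * septic_\<rho> (u * v) z t = 0" "7 * v^6 + 2*u * septic_\<rho> (u * v) z t = 0"
    using isotropic_coordinates(3,4)[of x y z t] assms(1,2) by (auto simp: uv)
  hence "7 * u^7 = 7 * v^7" by algebra
  hence 7: "u^7 = v^7" by simp
  define s where "s = u / v"
  have "s^7 = 1" using 7 nz by (simp add: s_def power_divide)
  \<comment> \<open>The square root: \<open>s^8 = s\<close>.\<close>
  define \<omega> where "\<omega> = s^4"
  have "\<omega>^7 = (s^7)^4" "\<omega>^2 = s^7 * s"
    unfolding \<omega>_def by (simp_all flip: power_mult power_Suc2)
  hence \<omega>7: "\<omega>^7 = 1" and \<omega>2: "\<omega>^2 = u / v"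
    unfolding \<open>s^7 = 1\<close> by (simp_all add: s_def)
  have w0: "\<omega> \<noteq> 0" using seventh_root_inverse[OF \<omega>7] by simp
  define r where "r = u / \<omega>"
  have ru: "r * \<omega> = u" using w0 by (simp add: r_def)
  have rv: "r * inverse \<omega> = v"
    using \<omega>2 nz w0 by (simp add: r_def field_simps power2_eq_square)
  have "rotate \<omega> (r, t) = (x, y, t)"
    using ru rv by (simp add: rotate_def distrib_left right_diff_distrib uv)
  moreover have "r \<noteq> 0" using ru nz by auto
  ultimately show thesis using that \<omega>7 by metis
qed

text \<open>On the axis the cubic does not vanish at a point of the surface, and its cofactor in the
  \<open>t\<close>-derivative is a multiple of \<open>t * (2 * t - 1) * (t + 1)\<close>. Only the root \<open>t = 0\<close> satisfies the
  equation of the surface.\<close>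

lemma axis_node:
  assumes "septic 0 0 1 t = 0" "septic_t 0 0 1 t = 0"
  shows "t = 0"
proof -
  have f: "- 64 + (1 + t) * (cubic 0 1 t)^2 = 0"
    using assms(1) by (simp add: septic_def P_def)
  hence "cubic 0 1 t \<noteq> 0" by auto
  hence "cubic 0 1 t + 2*(1 + t)*cubic_t 0 1 t = 0"
    using assms(2) by (simp add: septic_t_def)
  hence "28 * (t * ((2*t - 1) * (t + 1))) = 0"
    unfolding cubic_at_1 by algebra
  hence "t = 0 \<or> 2*t - 1 = 0 \<or> t + 1 = 0" by (simp only: mult_eq_0_iff) simp
  moreover have "2*t - 1 \<noteq> 0"
  proof
    assume "2*t - 1 = 0"
    hence "t = 1/2" by (simp add: field_simps)
    show False using f unfolding \<open>t = 1/2\<close> cubic_at_1 by (simp add: power2_eq_square power3_eq_cube)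
  qed
  moreover have "t + 1 \<noteq> 0"
  proof
    assume "t + 1 = 0"
    hence "1 + t = 0" by (simp only: add.commute)
    thus False using f by simp
  qed
  ultimately show ?thesis by blast
qed

text \<open>A point with \<open>x\<^sup>2 + y\<^sup>2 = 0\<close> but off the axis is impossible: one of the isotropic coordinates
  vanishes, and then the derivative conditions force the other to vanish as well.\<close>

lemma affine_nodes_eq:
  "affine_nodes = insert (0, 0, 0) ((\<lambda>(\<omega>, n). rotate \<omega> n) ` ({\<omega>. \<omega>^7 = 1} \<times> plane_nodes))"
  (is "_ = insert _ ?R")
proof (intro subset_antisym subsetI)
  fix p assume "p \<in> affine_nodes"
  then obtain x y t where p: "p = (x, y, t)" and
    s: "septic x y 1 t = 0" "septic_x x y 1 t = 0" "septic_y x y 1 t = 0" "septic_t x y 1 t = 0"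
    by (auto simp: affine_nodes_def)
  show "p \<in> insert (0, 0, 0) ?R"
  proof (cases "x^2 + y^2 = 0")
    case True
    have "(x + \<i> * y) * (x - \<i> * y) = 0"
      using True isotropic_coordinates(1)[of x y] by simp
    hence "x + \<i> * y = 0 \<and> x - \<i> * y = 0"
      using isotropic_coordinates(3,4)[of x y 1 t] s by auto
    hence "2 * x = 0" "2 * (\<i> * y) = 0" by algebra+
    hence "x = 0" "y = 0" by simp_all
    thus ?thesis using axis_node s p by auto
  next
    case False
    then obtain \<omega> r where w: "\<omega>^7 = 1" "r \<noteq> 0" "(x, y, t) = rotate \<omega> (r, t)"
      using singular_off_axis_rotation s by metis
    have "(r, t) \<in> plane_nodes"
      using rotate_singular_iff[OF w(1) w(3)[symmetric]] s w(2) by (intro plane_singular_imp_node) auto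
    thus ?thesis using w p by force
  qed
next
  fix p assume "p \<in> insert (0, 0, 0) ?R"
  then consider "p = (0, 0, 0)" | \<omega> r t where "\<omega>^7 = 1" "(r, t) \<in> plane_nodes" "p = rotate \<omega> (r, t)"
    by auto
  thus "p \<in> affine_nodes"
  proof cases
    case 1
    thus ?thesis
      by (simp add: affine_nodes_def septic_def septic_x_def septic_y_def septic_t_def cubic_at_1 P_def)
  next
    case 2
    have "rotate \<omega> (r, t) = (r * (\<omega> + inverse \<omega>) / 2, r * (\<omega> - inverse \<omega>) / (2 * \<i>), t)"
      by (simp add: rotate_def)
    then obtain x y where "rotate \<omega> (r, t) = (x, y, t)" by blast
    thus ?thesis
      using rotate_singular_iff[OF 2(1), of r t x y t] plane_node_imp_singular[OF 2(2)] 2(3)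
      by (simp add: affine_nodes_def)
  qed
qed

section \<open>Nondegeneracy\<close>

definition septic_\<rho>\<rho> :: "complex \<Rightarrow> complex \<Rightarrow> complex" where
  "septic_\<rho>\<rho> \<rho> t = 7*(6*\<rho> - 16) + 98*(1 + t)*t^2"
definition septic_\<rho>t :: "complex \<Rightarrow> complex \<Rightarrow> complex" where
  "septic_\<rho>t \<rho> t = 14*((1 + 2*t)*cubic \<rho> 1 t + t*(1 + t)*cubic_t \<rho> 1 t)"
definition septic_tt :: "complex \<Rightarrow> complex \<Rightarrow> complex" where
  "septic_tt \<rho> t = 4*cubic \<rho> 1 t*cubic_t \<rho> 1 t
     + 2*(1 + t)*((cubic_t \<rho> 1 t)^2 + cubic \<rho> 1 t*(8 - 48*t))"

text \<open>The determinant of the Hessian of \<open>septic x y 1 t\<close> with respect to \<open>(x, y, t)\<close>. In this form it is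
  visibly a function of \<open>t\<close>, \<open>\<rho>\<close> and \<open>h = Re ((x + \<i> * y)^7)\<close> (for real \<open>x\<close> and \<open>y\<close>), hence
  unchanged by the rotations.\<close>

definition septic_hessian_det :: "complex \<Rightarrow> complex \<Rightarrow> complex \<Rightarrow> complex" where
  "septic_hessian_det x y t = (let \<rho> = x^2 + y^2; h = x^7 - 21*x^5*y^2 + 35*x^3*y^4 - 7*x*y^6 in
     septic_tt \<rho> t * (4*(septic_\<rho> \<rho> 1 t)^2 + 8*\<rho> * septic_\<rho> \<rho> 1 t * septic_\<rho>\<rho> \<rho> t - 1764*\<rho>^5 - 168*h * septic_\<rho>\<rho> \<rho> t)
     - 8*(septic_\<rho>t \<rho> t)^2*(\<rho> * septic_\<rho> \<rho> 1 t - 21*h))"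

text \<open>The zeros of the cubic on a double line are simple: there the two curves cross transversally.\<close>

lemma cubic_t_nonzero_at_base_node:
  assumes "double_lines x = 0" "t = - x \<or> t = 1 - x^2/4 \<or> t = x^2/4 + x - 1/2"
  shows "cubic_t (x^2) 1 t \<noteq> 0"
proof -
  from assms(2) consider "t = - x" | "4*t = 4 - x^2" | "4*t = x^2 + 4*x - 2"
    unfolding clear_denominators by blast
  thus ?thesis
    using assms(1) unfolding cubic_at_1 double_lines_def by cases algebra+
qed

text \<open>Up to the factor \<open>49 * r^7\<close> this is the Hessian determinant at \<open>(r, 0, t)\<close>. At a node on a
  double line it is \<open>cubic_t\<^sup>2\<close> times a factor without zeros there, so transversality makes it nonzero; at the
  other nodes it reduces, modulo the minimal polynomial of \<open>r\<close>, to a polynomial coprime to that minimal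
  polynomial.\<close>

lemma plane_node_nondegenerate:
  assumes "(r, t) \<in> plane_nodes"
  shows "4*(septic_\<rho>t (r^2) t)^2 - septic_tt (r^2) t*(35*r^3 + 4 * septic_\<rho>\<rho> (r^2) t) \<noteq> 0"
    (is "?N \<noteq> 0")
proof -
  consider (base) "double_lines r = 0" "t = - r \<or> t = 1 - r^2/4 \<or> t = r^2/4 + r - 1/2"
    | (cubic) "r^3 - 2*r^2 - 8*r + 8 = 0" "4*t = 4 - r^2"
    | (quad) "5*r^2 - 2*r - 4 = 0" "t = - r"
    using assms by (auto simp: plane_nodes_def clear_denominators)
  thus ?thesis
  proof cases
    case base
    have c: "cubic (r^2) 1 t = 0" using cubic_factors base by blast
    have "?N = - 14*(1 + t)*(cubic_t (r^2) 1 t)^2*(5*r^3 + 24*r^2 - 64)"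
      unfolding septic_\<rho>t_def septic_tt_def septic_\<rho>\<rho>_def c by algebra
    also have "5*r^3 + 24*r^2 - 64 = 4*(r + 6)*(r - 1)"
      using base(1) unfolding double_lines_def by algebra
    finally have N: "?N = - 14*(1 + t)*(cubic_t (r^2) 1 t)^2*(4*(r + 6)*(r - 1))" .
    have "r \<noteq> 1" "r \<noteq> -6" "r \<noteq> 0"
      using base(1) by (auto simp: double_lines_def)
    moreover have "t \<noteq> - 1"
      using c \<open>r \<noteq> 0\<close> by (auto simp: cubic_at_1)
    ultimately show ?thesis
      unfolding N mult_eq_0_iff power_eq_0_iff using cubic_t_nonzero_at_base_node[OF base]
      by (auto simp: eq_neg_iff_add_eq_0 add.commute)
  next
    case cubic
    have "?N = 21952*(33*r^2 + 46*r - 68)"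
      using cubic unfolding septic_\<rho>t_def septic_tt_def septic_\<rho>\<rho>_def cubic_at_1 by algebra
    moreover have "33*r^2 + 46*r - 68 \<noteq> 0"
      using cubic(1) by algebra
    ultimately show ?thesis by (metis mult_eq_0_iff zero_neq_numeral)
  next
    case quad
    have "3125 * ?N = 131712*(1341*r + 2122)"
      using quad unfolding septic_\<rho>t_def septic_tt_def septic_\<rho>\<rho>_def cubic_at_1 by algebra
    moreover have "1341*r + 2122 \<noteq> 0"
      using quad(1) by algebra
    ultimately show ?thesis by (metis mult_eq_0_iff zero_neq_numeral)
  qed
qed

lemma septic_hessian_det_nonzero:
  assumes "(x, y, t) \<in> affine_nodes"
  shows "septic_hessian_det x y t \<noteq> 0"
proof -
  consider "x = 0" "y = 0" "t = 0"
    | \<omega> r where "\<omega>^7 = 1" "(r, t) \<in> plane_nodes" "rotate \<omega> (r, t) = (x, y, t)"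
    using assms unfolding affine_nodes_eq by (auto simp: rotate_def)
  thus ?thesis
  proof cases
    case 1
    thus ?thesis
      by (simp add: septic_hessian_det_def septic_tt_def septic_\<rho>_def cubic_at_1)
  next
    case 2
    define u v where uv: "u = x + \<i> * y" "v = x - \<i> * y"
    note w = seventh_root_inverse[OF 2(1)]
    have u: "u = r * \<omega>" and v: "v = r * inverse \<omega>"
      using rotate_coordinates[OF 2(3)] uv by auto
    have \<rho>: "x^2 + y^2 = r^2"
      using w(1) isotropic_coordinates(1)[of x y] unfolding uv[symmetric] unfolding u v
      by (simp add: power2_eq_square)
    have "u^7 + v^7 = 2 * r^7"
      using 2(1) unfolding u v by (simp add: power_mult_distrib power_inverse)
    moreover have "u^7 + v^7 = 2 * (x^7 - 21*x^5*y^2 + 35*x^3*y^4 - 7*x*y^6)"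
    proof -
      have "\<i>^2 = -1" by simp
      thus ?thesis unfolding uv by algebra
    qed
    ultimately have "2 * (x^7 - 21*x^5*y^2 + 35*x^3*y^4 - 7*x*y^6) = 2 * r^7" by (simp only:)
    hence h: "x^7 - 21*x^5*y^2 + 35*x^3*y^4 - 7*x*y^6 = r^7"
      by (simp only: mult_cancel_left) simp
    have r0: "r \<noteq> 0" using plane_nodes_nonzero[OF 2(2)] .
    have "r * (7*r^5 + 2 * septic_\<rho> (r^2) 1 t) = 0"
      using plane_node_imp_singular(2)[OF 2(2)] by (simp add: septic_x_def algebra_simps eval_nat_numeral)
    hence g: "2 * septic_\<rho> (r^2) 1 t = - 7*r^5"
      using r0 by (simp only: mult_eq_0_iff) (simp add: eq_neg_iff_add_eq_0 add.commute)
    have "septic_hessian_det x y t = 49*r^7*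
        (4*(septic_\<rho>t (r^2) t)^2 - septic_tt (r^2) t*(35*r^3 + 4 * septic_\<rho>\<rho> (r^2) t))"
      using g unfolding septic_hessian_det_def \<rho> h Let_def by algebra
    thus ?thesis using plane_node_nondegenerate[OF 2(2)] r0 by simp
  qed
qed

text \<open>These are the nine entries of the Hessian in the chart \<open>z = 1\<close>, where \<open>w\<close> enters through
  \<open>t = (1 + w) * k\<close>.\<close>

lemma septic_second_DERIV:
  fixes k :: complex
  defines "T \<equiv> \<lambda>w. (1 + w) * k"
  shows
  "((\<lambda>x. septic_x x y 1 (T w)) has_field_derivative
     42*(x^5 - 10*x^3*y^2 + 5*x*y^4) + 2 * septic_\<rho> (x^2+y^2) 1 (T w) + 4*x^2 * septic_\<rho>\<rho> (x^2+y^2) (T w)) (at x)"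
  "((\<lambda>y. septic_x x y 1 (T w)) has_field_derivative
     - 42*(5*x^4*y - 10*x^2*y^3 + y^5) + 4*x*y * septic_\<rho>\<rho> (x^2+y^2) (T w)) (at y)"
  "((\<lambda>w. septic_x x y 1 (T w)) has_field_derivative k*(2*x * septic_\<rho>t (x^2+y^2) (T w))) (at w)"
  "((\<lambda>x. septic_y x y 1 (T w)) has_field_derivative
     - 42*(5*x^4*y - 10*x^2*y^3 + y^5) + 4*x*y * septic_\<rho>\<rho> (x^2+y^2) (T w)) (at x)"
  "((\<lambda>y. septic_y x y 1 (T w)) has_field_derivative
     - 42*(x^5 - 10*x^3*y^2 + 5*x*y^4) + 2 * septic_\<rho> (x^2+y^2) 1 (T w) + 4*y^2 * septic_\<rho>\<rho> (x^2+y^2) (T w)) (at y)"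
  "((\<lambda>w. septic_y x y 1 (T w)) has_field_derivative k*(2*y * septic_\<rho>t (x^2+y^2) (T w))) (at w)"
  "((\<lambda>x. k * septic_t x y 1 (T w)) has_field_derivative k*(2*x * septic_\<rho>t (x^2+y^2) (T w))) (at x)"
  "((\<lambda>y. k * septic_t x y 1 (T w)) has_field_derivative k*(2*y * septic_\<rho>t (x^2+y^2) (T w))) (at y)"
  "((\<lambda>w. k * septic_t x y 1 (T w)) has_field_derivative k*(k * septic_tt (x^2+y^2) (T w))) (at w)"
  unfolding septic_x_def septic_y_def septic_t_def septic_\<rho>_def septic_\<rho>\<rho>_def septic_\<rho>t_def septic_tt_def
    cubic_at_1 T_def power_one mult_1_right
  by (auto intro!: derivative_eq_intros; algebra)+

section \<open>Counting the nodes and their reality\<close>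

text \<open>Sign changes give three real roots, and a cubic has no further complex ones. Counting the roots
  and proving that they are real is thus the same step.\<close>

lemma real_cubic_three_roots:
  fixes b c d u\<^sub>0 u\<^sub>1 u\<^sub>2 u\<^sub>3 :: real
  defines "p \<equiv> \<lambda>x. x^3 + b*x^2 + c*x + d"
  assumes less: "u\<^sub>0 < u\<^sub>1" "u\<^sub>1 < u\<^sub>2" "u\<^sub>2 < u\<^sub>3"
    and sgn: "p u\<^sub>0 < 0" "0 < p u\<^sub>1" "p u\<^sub>2 < 0" "0 < p u\<^sub>3"
  shows "card {z::complex. z^3 + b*z^2 + c*z + d = 0} = 3"
    and "{z::complex. z^3 + b*z^2 + c*z + d = 0} \<subseteq> \<real>"
proof -
  have cont: "continuous_on A p" for A
    unfolding p_def by (intro continuous_intros)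
  obtain r1 where r1: "u\<^sub>0 \<le> r1" "r1 \<le> u\<^sub>1" "p r1 = 0"
    using IVT'[of p u\<^sub>0 0 u\<^sub>1] less sgn cont by force
  obtain r2 where r2: "u\<^sub>1 \<le> r2" "r2 \<le> u\<^sub>2" "p r2 = 0"
    using IVT2'[of p u\<^sub>2 0 u\<^sub>1] less sgn cont by force
  obtain r3 where r3: "u\<^sub>2 \<le> r3" "r3 \<le> u\<^sub>3" "p r3 = 0"
    using IVT'[of p u\<^sub>2 0 u\<^sub>3] less sgn cont by force
  have "r1 \<noteq> u\<^sub>1" "r2 \<noteq> u\<^sub>2" using r1 r2 sgn by auto
  hence ord: "r1 < r2" "r2 < r3" using r1 r2 r3 by auto
  have "(r1 - r2) * (r1^2 + r1*r2 + r2^2 + b*(r1 + r2) + c) = 0"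
    "(r1 - r3) * (r1^2 + r1*r3 + r3^2 + b*(r1 + r3) + c) = 0"
    using r1(3) r2(3) r3(3) unfolding p_def by algebra+
  hence e: "r1^2 + r1*r2 + r2^2 + b*(r1 + r2) + c = 0" "r1^2 + r1*r3 + r3^2 + b*(r1 + r3) + c = 0"
    using ord by auto
  hence "(r2 - r3) * (r1 + r2 + r3 + b) = 0" by algebra
  hence b: "b = - (r1 + r2 + r3)" using ord by auto
  have c: "c = r1*r2 + r1*r3 + r2*r3" using e(1) unfolding b by algebra
  have d: "d = - (r1*r2*r3)" using r1(3) unfolding p_def b c by algebra
  have "z^3 + b*z^2 + c*z + d = (z - r1) * (z - r2) * (z - r3)" for z :: complex
    unfolding b c d by simp algebra
  hence roots: "{z::complex. z^3 + b*z^2 + c*z + d = 0} = {of_real r1, of_real r2, of_real r3}"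
    by auto
  show "card {z::complex. z^3 + b*z^2 + c*z + d = 0} = 3"
    unfolding roots using ord by simp
  show "{z::complex. z^3 + b*z^2 + c*z + d = 0} \<subseteq> \<real>"
    unfolding roots by simp
qed

lemma double_lines_roots:
  "card {x. double_lines x = 0} = 3" "{x. double_lines x = 0} \<subseteq> \<real>"
  using real_cubic_three_roots[of "-5" "-2" 0 2 4 "-4" "-8"]
  by (simp_all add: double_lines_def)

lemma residual_cubic_roots:
  "card {x::complex. x^3 - 2*x^2 - 8*x + 8 = 0} = 3" "{x::complex. x^3 - 2*x^2 - 8*x + 8 = 0} \<subseteq> \<real>"
  using real_cubic_three_roots[of "-3" 0 2 4 "-2" "-8" 8]
  by simp_all

lemma residual_quadratic_roots:
  "card {x::complex. 5*x^2 - 2*x - 4 = 0} = 2" "{x::complex. 5*x^2 - 2*x - 4 = 0} \<subseteq> \<real>"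
proof -
  define s where "s = complex_of_real (sqrt 21)"
  have s: "s^2 = 21" by (simp add: s_def flip: of_real_power)
  have "5 * (5*x^2 - 2*x - 4) = (5*x - (1 + s)) * (5*x - (1 - s))" for x
    using s by (simp add: algebra_simps power2_eq_square)
  hence "5*x^2 - 2*x - 4 = 0 \<longleftrightarrow> 5*x = 1 + s \<or> 5*x = 1 - s" for x
    by (metis mult_eq_0_iff right_minus_eq zero_neq_numeral)
  moreover have "5*x = a \<longleftrightarrow> x = a/5" for x a :: complex
    by (auto simp: eq_divide_eq)
  ultimately have roots: "{x. 5*x^2 - 2*x - 4 = 0} = {(1 + s)/5, (1 - s)/5}"
    by blast
  have "s \<noteq> 0" using s by auto
  thus "card {x::complex. 5*x^2 - 2*x - 4 = 0} = 2"
    unfolding roots by (simp add: eq_neg_iff_add_eq_0)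
  show "{x::complex. 5*x^2 - 2*x - 4 = 0} \<subseteq> \<real>"
    unfolding roots s_def by simp
qed

lemma plane_nodes_real:
  assumes "(r, t) \<in> plane_nodes" shows "r \<in> \<real>" "t \<in> \<real>"
proof -
  show r: "r \<in> \<real>"
    using assms double_lines_roots(2) residual_cubic_roots(2) residual_quadratic_roots(2)
    unfolding plane_nodes_def by blast
  have "t = - r \<or> t = 1 - r^2/4 \<or> t = r^2/4 + r - 1/2"
    using assms unfolding plane_nodes_def by blast
  thus "t \<in> \<real>" using r by (auto intro!: Reals_diff Reals_add Reals_divide)
qed

text \<open>Three values of \<open>x\<close> with three values of \<open>t\<close> each, three with one, and two with one; these
  groups are disjoint because the polynomials for \<open>x\<close> are pairwise coprime.\<close>

lemma card_plane_nodes: "card plane_nodes = 14"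
proof -
  let ?A = "{x. double_lines x = 0}" and ?B = "{x::complex. x^3 - 2*x^2 - 8*x + 8 = 0}"
    and ?Q = "{x::complex. 5*x^2 - 2*x - 4 = 0}"
  let ?T = "\<lambda>x::complex. {- x, 1 - x^2/4, x^2/4 + x - 1/2}"
  have split: "plane_nodes = Sigma ?A ?T \<union> (Sigma ?B (\<lambda>x. {1 - x^2/4}) \<union> Sigma ?Q (\<lambda>x. {- x}))"
    by (auto simp: plane_nodes_def)
  have fin: "finite ?A" "finite ?B" "finite ?Q"
    using double_lines_roots(1) residual_cubic_roots(1) residual_quadratic_roots(1)
    by (metis card.infinite zero_neq_numeral)+
  have "?A \<inter> (?B \<union> ?Q) = {}"
  proof -
    have False if "double_lines x = 0" "x^3 - 2*x^2 - 8*x + 8 = 0" for x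
      using that unfolding double_lines_def by algebra
    moreover have False if "double_lines x = 0" "5*x^2 - 2*x - 4 = 0" for x
      using that unfolding double_lines_def by algebra
    ultimately show ?thesis by blast
  qed
  moreover have "?B \<inter> ?Q = {}"
  proof -
    have False if "x^3 - 2*x^2 - 8*x + 8 = 0" "5*x^2 - 2*x - 4 = 0" for x :: complex
      using that by algebra
    thus ?thesis by blast
  qed
  ultimately have disj: "Sigma ?A ?T \<inter> (Sigma ?B (\<lambda>x. {1 - x^2/4}) \<union> Sigma ?Q (\<lambda>x. {- x})) = {}"
    "Sigma ?B (\<lambda>x. {1 - x^2/4}) \<inter> Sigma ?Q (\<lambda>x. {- x}) = {}" by blast+
  have T: "card (?T x) = 3" if "x \<in> ?A" for x
  proof -
    have x: "x^3 + 4*x^2 - 4*x - 8 = 0" using that by (simp add: double_lines_def)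
    have "4 * (- x) \<noteq> 4 - x^2" "4 * (- x) \<noteq> x^2 + 4*x - 2" "4 - x^2 \<noteq> x^2 + 4*x - 2"
      using x by algebra+
    hence "- x \<noteq> 1 - x^2/4" "- x \<noteq> x^2/4 + x - 1/2" "1 - x^2/4 \<noteq> x^2/4 + x - 1/2"
      unfolding clear_denominators by (auto simp: algebra_simps)
    thus ?thesis by simp
  qed
  have "card (Sigma ?A ?T) = 9"
    using T double_lines_roots(1) fin by (subst card_SigmaI) auto
  moreover have "card (Sigma ?B (\<lambda>x. {1 - x^2/4})) = 3"
    using residual_cubic_roots(1) fin by (subst card_SigmaI) auto
  moreover have "card (Sigma ?Q (\<lambda>x. {- x})) = 2"
    using residual_quadratic_roots(1) fin by (subst card_SigmaI) auto
  ultimately show ?thesis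
    unfolding split using disj fin by (simp add: card_Un_disjoint)
qed

text \<open>From a rotated point one recovers \<open>r\<^sup>2\<close> as \<open>x\<^sup>2 + y\<^sup>2\<close> and \<open>r^7\<close> as \<open>(x + \<i> * y)^7\<close>, which together
  determine \<open>r\<close> since 2 and 7 are coprime.\<close>

lemma inj_on_rotate:
  "inj_on (\<lambda>(\<omega>, n). rotate \<omega> n) ({\<omega>. \<omega>^7 = 1} \<times> plane_nodes)"
proof (rule inj_onI, clarsimp)
  fix \<omega> r t \<omega>' r' t'
  assume w: "\<omega>^7 = (1::complex)" "\<omega>'^7 = (1::complex)" and n: "(r, t) \<in> plane_nodes" "(r', t') \<in> plane_nodes"
    and eq: "rotate \<omega> (r, t) = rotate \<omega>' (r', t')"
  obtain x y s where xy: "rotate \<omega> (r, t) = (x, y, s)" by (metis prod_cases3)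
  note c = rotate_coordinates[OF xy] rotate_coordinates[OF xy[unfolded eq]]
  note w0 = seventh_root_inverse(1)[OF w(1)] seventh_root_inverse(1)[OF w(2)]
  have u: "r * \<omega> = r' * \<omega>'" and v: "r * inverse \<omega> = r' * inverse \<omega>'" and t: "t = t'"
    using c by metis+
  have "(r * \<omega>) * (r * inverse \<omega>) = (r' * \<omega>') * (r' * inverse \<omega>')"
    unfolding u v ..
  hence 2: "r^2 = r'^2" using w0 by (simp add: field_simps power2_eq_square)
  have "(r * \<omega>)^7 = (r' * \<omega>')^7" unfolding u ..
  hence 7: "r^7 = r'^7" using w by (simp add: power_mult_distrib)
  have "r * (r^2)^3 = r' * (r'^2)^3" using 7 by (simp flip: power_mult power_Suc)
  hence "(r - r') * (r^2)^3 = 0" unfolding 2[symmetric] by (simp add: algebra_simps)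
  hence r: "r = r'" using plane_nodes_nonzero[OF n(1)] by simp
  thus "\<omega> = \<omega>' \<and> r = r' \<and> t = t'" using u t plane_nodes_nonzero[OF n(1)] by simp
qed

lemma card_affine_nodes: "card affine_nodes = 99"
proof -
  let ?R = "(\<lambda>(\<omega>, n). rotate \<omega> n) ` ({\<omega>. \<omega>^7 = 1} \<times> plane_nodes)"
  have "(0, 0, 0) \<notin> ?R"
  proof
    assume "(0, 0, 0) \<in> ?R"
    then obtain \<omega> r t where w: "\<omega>^7 = 1" and n: "(r, t) \<in> plane_nodes" and "rotate \<omega> (r, t) = (0, 0, 0)"
      by force
    hence "r * \<omega> = 0" using rotate_coordinates(1) by fastforce
    thus False using plane_nodes_nonzero[OF n] seventh_root_inverse(1)[OF w] by simp
  qed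
  moreover have "card ?R = 98"
    using inj_on_rotate card_roots_unity_eq[of 7] card_plane_nodes
    by (simp add: card_image card_cartesian_product)
  moreover hence "finite ?R" by (metis card.infinite zero_neq_numeral)
  ultimately show ?thesis unfolding affine_nodes_eq by simp
qed

lemma affine_nodes_real:
  assumes "(x, y, t) \<in> affine_nodes" shows "x \<in> \<real>" "y \<in> \<real>" "t \<in> \<real>"
proof -
  have "x \<in> \<real> \<and> y \<in> \<real> \<and> t \<in> \<real>"
  proof (cases "(x, y, t) = (0, 0, 0)")
    case False
    then obtain \<omega> r where w: "\<omega>^7 = 1" and n: "(r, t) \<in> plane_nodes"
      and xy: "x = r * (\<omega> + inverse \<omega>) / 2" "y = r * (\<omega> - inverse \<omega>) / (2 * \<i>)"
      using assms unfolding affine_nodes_eq by (auto simp: rotate_def)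
    have "norm \<omega> = 1" using power_eq_1_iff[OF w] by simp
    hence "inverse \<omega> = cnj \<omega>"
      using divide_conv_cnj[of \<omega> 1] by (simp add: inverse_eq_divide)
    hence "\<omega> + inverse \<omega> = 2 * Re \<omega>" "\<omega> - inverse \<omega> = 2 * \<i> * Im \<omega>"
      by (simp_all add: complex_add_cnj complex_diff_cnj)
    moreover have "\<i> * y = r * (\<omega> - inverse \<omega>) / 2" by (simp add: xy)
    ultimately have "x = r * Re \<omega>" "\<i> * y = \<i> * (r * Im \<omega>)"
      using xy by simp_all
    hence "x = r * Re \<omega>" "y = r * Im \<omega>" by (simp_all only: mult_cancel_left) (simp_all only: complex_i_not_zero simp_thms)
    thus ?thesis using plane_nodes_real[OF n] by simp
  qed simp
  thus "x \<in> \<real>" "y \<in> \<real>" "t \<in> \<real>" by auto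
qed

section \<open>Singular points in projective space\<close>

lemma DERIV_at_offset:
  "(g has_field_derivative D) (at a) \<Longrightarrow> ((\<lambda>t. g (a + t)) has_field_derivative D) (at 0)"
  using DERIV_shift[of g D 0 a] by (simp add: add.commute)

lemma partial_deriv_4:
  fixes f :: "complex \<Rightarrow> complex \<Rightarrow> complex \<Rightarrow> complex \<Rightarrow> complex" and v :: "complex^4"
  defines "F \<equiv> \<lambda>v::complex^4. f (v$1) (v$2) (v$3) (v$4)"
  shows "((\<lambda>x. f x (v$2) (v$3) (v$4)) has_field_derivative D) (at (v$1)) \<Longrightarrow> partial_deriv 1 F v = D"
    and "((\<lambda>x. f (v$1) x (v$3) (v$4)) has_field_derivative D) (at (v$2)) \<Longrightarrow> partial_deriv 2 F v = D"
    and "((\<lambda>x. f (v$1) (v$2) x (v$4)) has_field_derivative D) (at (v$3)) \<Longrightarrow> partial_deriv 3 F v = D"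
    and "((\<lambda>x. f (v$1) (v$2) (v$3) x) has_field_derivative D) (at (v$4)) \<Longrightarrow> partial_deriv 4 F v = D"
  unfolding partial_deriv_def F_def axis_def
  by (drule DERIV_at_offset, rule DERIV_imp_deriv, simp)+

lemma partial_deriv_3:
  fixes f :: "complex \<Rightarrow> complex \<Rightarrow> complex \<Rightarrow> complex" and v :: "complex^3"
  defines "F \<equiv> \<lambda>v::complex^3. f (v$1) (v$2) (v$3)"
  shows "((\<lambda>x. f x (v$2) (v$3)) has_field_derivative D) (at (v$1)) \<Longrightarrow> partial_deriv 1 F v = D"
    and "((\<lambda>x. f (v$1) x (v$3)) has_field_derivative D) (at (v$2)) \<Longrightarrow> partial_deriv 2 F v = D"
    and "((\<lambda>x. f (v$1) (v$2) x) has_field_derivative D) (at (v$3)) \<Longrightarrow> partial_deriv 3 F v = D"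
  unfolding partial_deriv_def F_def axis_def
  by (drule DERIV_at_offset, rule DERIV_imp_deriv, simp)+

lemma S_partial_derivs:
  assumes \<alpha>: "7 * \<alpha>^3 + 7 * \<alpha> + 1 = 0"
  defines "k \<equiv> 1 / (7*\<alpha>)"
  defines "T \<equiv> \<lambda>v::complex^4. (v$3 + v$4) * k"
  shows "partial_deriv 1 (S \<alpha>) v = septic_x (v$1) (v$2) (v$3) (T v)"
    and "partial_deriv 2 (S \<alpha>) v = septic_y (v$1) (v$2) (v$3) (T v)"
    and "partial_deriv 3 (S \<alpha>) v = septic_z (v$1) (v$2) (v$3) (T v) + k * septic_t (v$1) (v$2) (v$3) (T v)"
    and "partial_deriv 4 (S \<alpha>) v = k * septic_t (v$1) (v$2) (v$3) (T v)"
proof -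
  have S: "S \<alpha> = (\<lambda>v. septic (v$1) (v$2) (v$3) ((v$3 + v$4) * k))"
    using S_eq_septic[OF \<alpha>] by (simp add: fun_eq_iff k_def)
  show "partial_deriv 1 (S \<alpha>) v = septic_x (v$1) (v$2) (v$3) (T v)"
    and "partial_deriv 2 (S \<alpha>) v = septic_y (v$1) (v$2) (v$3) (T v)"
    and "partial_deriv 3 (S \<alpha>) v = septic_z (v$1) (v$2) (v$3) (T v) + k * septic_t (v$1) (v$2) (v$3) (T v)"
    and "partial_deriv 4 (S \<alpha>) v = k * septic_t (v$1) (v$2) (v$3) (T v)"
    unfolding S T_def
    by (rule partial_deriv_4[where f = "\<lambda>x y z w. septic x y z ((z + w) * k)"]; rule septic_DERIV)+
qed

definition critical :: "complex \<Rightarrow> complex \<Rightarrow> complex \<Rightarrow> complex \<Rightarrow> bool" where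
  "critical x y z t \<longleftrightarrow> septic_x x y z t = 0 \<and> septic_y x y z t = 0 \<and> septic_z x y z t = 0 \<and> septic_t x y z t = 0"

lemma S_singular_iff:
  assumes \<alpha>: "7 * \<alpha>^3 + 7 * \<alpha> + 1 = 0"
  shows "S \<alpha> v = 0 \<and> (\<forall>i. partial_deriv i (S \<alpha>) v = 0) \<longleftrightarrow>
    critical (v$1) (v$2) (v$3) ((v$3 + v$4) / (7*\<alpha>))"
proof -
  have "S \<alpha> v = 0" if "critical (v$1) (v$2) (v$3) ((v$3 + v$4) / (7*\<alpha>))"
    using septic_Euler[of "v$1" "v$2" "v$3" "(v$3 + v$4) / (7*\<alpha>)"] that
    by (simp add: S_eq_septic[OF \<alpha>] critical_def)
  thus ?thesis
    using root_nonzero[OF \<alpha>] by (auto simp: forall_4 S_partial_derivs[OF \<alpha>] critical_def)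
qed

text \<open>The form has no critical point on the plane \<open>z = 0\<close> apart from the origin, so that no
  singularity escapes from the chart \<open>z = 1\<close>.\<close>

lemma critical_at_z_0:
  assumes "critical x y 0 t" shows "x = 0 \<and> y = 0 \<and> t = 0"
proof -
  define \<rho> where "\<rho> = x^2 + y^2"
  define u v where uv: "u = x + \<i> * y" "v = x - \<i> * y"
  have \<rho>: "\<rho> = u * v" using isotropic_coordinates(1)[of x y] by (simp add: uv \<rho>_def)
  have c: "septic_x x y 0 t = 0" "septic_y x y 0 t = 0" "septic_z x y 0 t = 0" "septic_t x y 0 t = 0"
    using assms by (auto simp: critical_def)
  have gx: "7*u^6 + 2 * v * septic_\<rho> \<rho> 0 t = 0" "7 * v^6 + 2*u * septic_\<rho> \<rho> 0 t = 0"
    using isotropic_coordinates(3,4)[of x y 0 t] c(1,2) by (auto simp: uv[symmetric] \<rho>)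
  have g: "septic_\<rho> \<rho> 0 t = 14*t^3*(7*\<rho> - 8*t^2)"
    by (simp add: septic_\<rho>_def cubic_def) algebra
  have "7 * (t^2*(7*\<rho> - 8*t^2)*(3*\<rho> - 8*t^2)) = 0"
    using c(4) unfolding septic_t_def cubic_def cubic_t_def \<rho>_def[symmetric] by simp algebra
  then consider "t = 0 \<or> 7*\<rho> - 8*t^2 = 0" | "3*\<rho> - 8*t^2 = 0"
    by auto
  hence "\<rho> = 0 \<and> t = 0"
  proof cases
    case 1
    hence "septic_\<rho> \<rho> 0 t = 0" by (auto simp: g)
    hence "u = 0" using gx by simp
    hence "\<rho> = 0" by (simp add: \<rho>)
    thus ?thesis using 1 by auto
  next
    case 2
    have "7*\<rho>^3 + (t*(7*\<rho> - 8*t^2)) * (t*(7*\<rho> - 8*t^2) + 8*t^3) = 0"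
      using c(3) unfolding septic_z_def cubic_def \<rho>_def[symmetric] by simp algebra
    hence "35 * \<rho>^3 = 0" using 2 by algebra
    thus ?thesis using 2 by simp
  qed
  hence "septic_\<rho> \<rho> 0 t = 0" unfolding g by simp
  hence "u = 0" "v = 0" using gx by simp_all
  hence "2 * x = 0" "2 * (\<i> * y) = 0" unfolding uv by algebra+
  thus ?thesis using \<open>\<rho> = 0 \<and> t = 0\<close> by simp
qed

lemma critical_affine_iff: "critical x y 1 t \<longleftrightarrow> (x, y, t) \<in> affine_nodes"
  using septic_Euler[of x y 1 t] by (auto simp: critical_def affine_nodes_def)

lemma critical_scale:
  assumes "c \<noteq> 0" shows "critical (c * x) (c * y) (c * z) (c * t) \<longleftrightarrow> critical x y z t"
  using assms by (simp add: critical_def septic_partials_homogeneous)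

definition node_point :: "complex \<Rightarrow> complex \<times> complex \<times> complex \<Rightarrow> (complex^4) set" where
  "node_point \<alpha> = (\<lambda>(x, y, t). proj_rel `` {affine_chart 3 (vector [x, y, 7*\<alpha>*t - 1])})"

lemma affine_chart_3: "affine_chart 3 (vector [x, y, w]) = vector [x, y, 1, w]"
  by (simp add: affine_chart_def)

lemma vector_1_nonzero: "(vector [x, y, 1, w] :: complex^4) \<noteq> 0"
  by (simp add: vec_eq_iff forall_4)

lemma node_point_in_P3: "node_point \<alpha> n \<in> P3"
  unfolding node_point_def P3_def
  by (auto intro!: quotientI simp: vector_1_nonzero affine_chart_3 split: prod.splits)

lemma chart_in_node_point:
  "affine_chart 3 (vector [x, y, 7*\<alpha>*t - 1]) \<in> node_point \<alpha> (x, y, t)"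
  unfolding node_point_def prod.case
  by (rule equiv_class_self[OF equiv_proj_rel]) (simp add: vector_1_nonzero affine_chart_3)

lemma singular_point_iff_node:
  assumes \<alpha>: "7 * \<alpha>^3 + 7 * \<alpha> + 1 = 0"
  shows "singular_point (S \<alpha>) p \<longleftrightarrow> p \<in> node_point \<alpha> ` affine_nodes"
proof
  assume "singular_point (S \<alpha>) p"
  then obtain v where p: "p \<in> P3" "v \<in> p" and crit: "critical (v$1) (v$2) (v$3) ((v$3 + v$4) / (7*\<alpha>))"
    unfolding singular_point_def S_singular_iff[OF \<alpha>] by auto
  define z t where "z = v$3" and "t = (v$3 + v$4) / (7*\<alpha>)"
  have w: "v$4 = 7*\<alpha>*t - z" using root_nonzero[OF \<alpha>] by (simp add: z_def t_def)
  from p obtain v' where v': "p = proj_rel `` {v'}" "(v', v) \<in> proj_rel"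
    unfolding P3_def by (auto elim!: quotientE)
  hence v0: "v \<noteq> 0" by (simp add: proj_rel_def)
  have cls: "p = proj_rel `` {v}"
    using equiv_class_eq[OF equiv_proj_rel v'(2)] v'(1) by simp
  have "z \<noteq> 0"
  proof
    assume "z = 0"
    hence "v$1 = 0 \<and> v$2 = 0 \<and> t = 0"
      using crit critical_at_z_0 unfolding z_def t_def by metis
    thus False using v0 w \<open>z = 0\<close> by (simp add: vec_eq_iff forall_4 z_def)
  qed
  have "critical (z * (v$1 / z)) (z * (v$2 / z)) (z * 1) (z * (t / z))"
    using crit[folded t_def, folded z_def] \<open>z \<noteq> 0\<close> by simp
  hence n: "(v$1 / z, v$2 / z, t / z) \<in> affine_nodes"
    unfolding critical_scale[OF \<open>z \<noteq> 0\<close>] critical_affine_iff .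
  have "affine_chart 3 (vector [v$1 / z, v$2 / z, 7*\<alpha>*(t / z) - 1]) = (1 / z) *s v"
    using \<open>z \<noteq> 0\<close>
    by (simp add: affine_chart_3 vec_eq_iff forall_4 w diff_divide_distrib z_def[symmetric])
  hence "(v, affine_chart 3 (vector [v$1 / z, v$2 / z, 7*\<alpha>*(t / z) - 1])) \<in> proj_rel"
    using v0 by (auto simp: proj_rel_def affine_chart_3 vector_1_nonzero)
  hence "p = node_point \<alpha> (v$1 / z, v$2 / z, t / z)"
    unfolding cls node_point_def prod.case by (rule equiv_class_eq[OF equiv_proj_rel])
  thus "p \<in> node_point \<alpha> ` affine_nodes" using n by blast
next
  assume "p \<in> node_point \<alpha> ` affine_nodes"
  then obtain x y t where n: "(x, y, t) \<in> affine_nodes" and p: "p = node_point \<alpha> (x, y, t)"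
    by auto
  have "critical x y 1 ((1 + (7*\<alpha>*t - 1)) / (7*\<alpha>))"
    using n root_nonzero[OF \<alpha>] by (simp add: critical_affine_iff)
  hence "S \<alpha> (affine_chart 3 (vector [x, y, 7*\<alpha>*t - 1])) = 0
      \<and> (\<forall>i. partial_deriv i (S \<alpha>) (affine_chart 3 (vector [x, y, 7*\<alpha>*t - 1])) = 0)"
    unfolding S_singular_iff[OF \<alpha>] by (simp add: affine_chart_3)
  thus "singular_point (S \<alpha>) p"
    unfolding singular_point_def p using node_point_in_P3 chart_in_node_point by blast
qed

lemma inj_node_point:
  assumes "\<alpha> \<noteq> 0" shows "inj (node_point \<alpha>)"
proof (rule injI, clarsimp)
  fix x y t x' y' t'
  assume "node_point \<alpha> (x, y, t) = node_point \<alpha> (x', y', t')"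
  hence "affine_chart 3 (vector [x', y', 7*\<alpha>*t' - 1]) \<in> node_point \<alpha> (x, y, t)"
    using chart_in_node_point by blast
  then obtain c where "(vector [x', y', 1, 7*\<alpha>*t' - 1] :: complex^4) = c *s vector [x, y, 1, 7*\<alpha>*t - 1]"
    by (auto simp: node_point_def proj_rel_def affine_chart_3)
  hence "x' = c * x" "y' = c * y" "c = 1" "7*\<alpha>*t' - 1 = c * (7*\<alpha>*t - 1)"
    by (simp_all add: vec_eq_iff forall_4)
  thus "x = x' \<and> y = y' \<and> t = t'" using assms by simp
qed

text \<open>The chart \<open>z = 1\<close> is convenient because there \<open>w\<close> is an affine function of \<open>t\<close> alone, so the
  change of coordinates contributes only the constant \<open>k\<^sup>2\<close>.\<close>

lemma det_hessian_chart:
  assumes \<alpha>: "7 * \<alpha>^3 + 7 * \<alpha> + 1 = 0"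
  defines "k \<equiv> 1 / (7*\<alpha>)"
  shows "det (hessian (S \<alpha> \<circ> affine_chart 3) u) = k^2 * septic_hessian_det (u$1) (u$2) ((1 + u$3) * k)"
proof -
  let ?F = "S \<alpha> \<circ> affine_chart 3"
  have F: "?F = (\<lambda>u. septic (u$1) (u$2) 1 ((1 + u$3) * k))"
    using S_eq_septic[OF \<alpha>] by (simp add: fun_eq_iff k_def affine_chart_def)
  have 1: "partial_deriv 1 ?F = (\<lambda>u. septic_x (u$1) (u$2) 1 ((1 + u$3) * k))"
    unfolding F by (rule ext, rule partial_deriv_3[where f = "\<lambda>x y w. septic x y 1 ((1 + w) * k)"], rule septic_DERIV)
  have 2: "partial_deriv 2 ?F = (\<lambda>u. septic_y (u$1) (u$2) 1 ((1 + u$3) * k))"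
    unfolding F by (rule ext, rule partial_deriv_3[where f = "\<lambda>x y w. septic x y 1 ((1 + w) * k)"], rule septic_DERIV)
  have 3: "partial_deriv 3 ?F = (\<lambda>u. k * septic_t (u$1) (u$2) 1 ((1 + u$3) * k))"
    unfolding F by (rule ext, rule partial_deriv_3[where f = "\<lambda>x y w. septic x y 1 ((1 + w) * k)"], rule septic_DERIV)
  define x y t \<rho> where xyt: "x = u$1" "y = u$2" "t = (1 + u$3) * k" "\<rho> = x^2 + y^2"
  \<comment> \<open>Abbreviations that keep the entries opaque for the final polynomial identity.\<close>
  define a b where "a = 42*(x^5 - 10*x^3*y^2 + 5*x*y^4)" and "b = 42*(5*x^4*y - 10*x^2*y^3 + y^5)"
  define g g2 gt where "g = septic_\<rho> \<rho> 1 t" and "g2 = septic_\<rho>\<rho> \<rho> t" and "gt = septic_\<rho>t \<rho> t"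
  define M where "M = hessian ?F u"
  note rules =
    partial_deriv_3(1)[where f = "\<lambda>x y w. septic_x x y 1 ((1 + w) * k)", OF septic_second_DERIV(1)]
    partial_deriv_3(2)[where f = "\<lambda>x y w. septic_x x y 1 ((1 + w) * k)", OF septic_second_DERIV(2)]
    partial_deriv_3(3)[where f = "\<lambda>x y w. septic_x x y 1 ((1 + w) * k)", OF septic_second_DERIV(3)]
    partial_deriv_3(1)[where f = "\<lambda>x y w. septic_y x y 1 ((1 + w) * k)", OF septic_second_DERIV(4)]
    partial_deriv_3(2)[where f = "\<lambda>x y w. septic_y x y 1 ((1 + w) * k)", OF septic_second_DERIV(5)]
    partial_deriv_3(3)[where f = "\<lambda>x y w. septic_y x y 1 ((1 + w) * k)", OF septic_second_DERIV(6)]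
    partial_deriv_3(1)[where f = "\<lambda>x y w. k * septic_t x y 1 ((1 + w) * k)", OF septic_second_DERIV(7)]
    partial_deriv_3(2)[where f = "\<lambda>x y w. k * septic_t x y 1 ((1 + w) * k)", OF septic_second_DERIV(8)]
    partial_deriv_3(3)[where f = "\<lambda>x y w. k * septic_t x y 1 ((1 + w) * k)", OF septic_second_DERIV(9)]
  have M: "M$1$1 = a + 2*g + 4*x^2*g2" "M$2$1 = - b + 4*x*y*g2" "M$3$1 = k*(2*x*gt)"
    "M$1$2 = - b + 4*x*y*g2" "M$2$2 = - a + 2*g + 4*y^2*g2" "M$3$2 = k*(2*y*gt)"
    "M$1$3 = k*(2*x*gt)" "M$2$3 = k*(2*y*gt)" "M$3$3 = k*(k * septic_tt \<rho> t)"
    by (simp_all add: M_def hessian_def 1 2 3 rules a_def b_def g_def g2_def gt_def flip: xyt)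
  have "det M = k^2 * septic_hessian_det x y t"
    unfolding det_3 M septic_hessian_det_def Let_def xyt(4)[symmetric] g_def[symmetric]
      g2_def[symmetric] gt_def[symmetric]
    unfolding a_def b_def xyt(4) by algebra
  thus ?thesis by (simp add: M_def xyt)
qed

lemma node_point_ordinary:
  assumes \<alpha>: "7 * \<alpha>^3 + 7 * \<alpha> + 1 = 0" and n: "n \<in> affine_nodes"
  shows "ordinary_double_point (S \<alpha>) (node_point \<alpha> n)"
proof -
  obtain x y t where xyt: "n = (x, y, t)" by (metis prod_cases3)
  have "det (hessian (S \<alpha> \<circ> affine_chart 3) (vector [x, y, 7*\<alpha>*t - 1])) \<noteq> 0"
    using septic_hessian_det_nonzero n root_nonzero[OF \<alpha>] unfolding det_hessian_chart[OF \<alpha>] xyt by simp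
  thus ?thesis
    using singular_point_iff_node[OF \<alpha>] n chart_in_node_point
    unfolding ordinary_double_point_def xyt by blast
qed

lemma node_point_real:
  assumes "\<alpha> \<in> \<real>" "n \<in> affine_nodes" shows "real_point (node_point \<alpha> n)"
proof -
  obtain x y t where xyt: "n = (x, y, t)" by (metis prod_cases3)
  have "\<forall>i. affine_chart 3 (vector [x, y, 7*\<alpha>*t - 1]) $ i \<in> \<real>"
    using affine_nodes_real assms unfolding xyt by (simp add: affine_chart_3 forall_4)
  thus ?thesis
    unfolding real_point_def xyt using node_point_in_P3 chart_in_node_point by blast
qed


section \<open>The real root\<close>

text \<open>The cubic is strictly increasing on the reals and changes sign within the stated error of the
  decimal approximation.\<close>

lemma unique_real_root:
  "\<exists>!r::real. 7 * r^3 + 7 * r + 1 = 0"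
  and root_approx: "7 * r^3 + 7 * r + 1 = (0::real) \<Longrightarrow> \<bar>r - (- 0.14010685)\<bar> \<le> 5 / 10^9"
proof -
  define p where "p = (\<lambda>r::real. 7 * r^3 + 7 * r + 1)"
  have mono: "p a < p b" if "a < b" for a b
    using that power_mono_odd[of 3 a b] by (simp add: p_def)
  have lo: "p (- 0.14010685 - 5 / 10^9) < 0" and hi: "0 < p (- 0.14010685 + 5 / 10^9)"
    by (simp_all add: p_def power3_eq_cube)
  have "continuous_on A p" for A unfolding p_def by (intro continuous_intros)
  then obtain r where "p r = 0"
    using IVT'[of p "- 0.14010685 - 5 / 10^9" 0 "- 0.14010685 + 5 / 10^9"] lo hi by fastforce
  moreover have "s = r" if "p s = 0" "p r = 0" for s r
    using mono[of s r] mono[of r s] that by linarith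
  ultimately show "\<exists>!r::real. 7 * r^3 + 7 * r + 1 = 0" unfolding p_def by blast
  show "\<bar>r - (- 0.14010685)\<bar> \<le> 5 / 10^9" if "7 * r^3 + 7 * r + 1 = (0::real)" for r
    using that mono[of r "- 0.14010685 - 5 / 10^9"] mono[of "- 0.14010685 + 5 / 10^9" r] lo hi
    unfolding p_def by linarith
qed

section \<open>Homogeneity\<close>

text \<open>Homogeneous forms of a fixed degree are closed under sums, and degrees add under products; this
  replaces an explicit list of the coefficients of \<open>S \<alpha>\<close>.\<close>

definition monomial_sum :: "nat \<Rightarrow> (('n::finite \<Rightarrow> nat) \<Rightarrow> complex) \<Rightarrow> complex^'n \<Rightarrow> complex" where
  "monomial_sum d c v = (\<Sum>e | sum e UNIV = d. c e * (\<Prod>i\<in>UNIV. (v $ i) ^ e i))"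

definition form :: "nat \<Rightarrow> (complex^'n::finite \<Rightarrow> complex) \<Rightarrow> bool" where
  "form d F \<longleftrightarrow> (\<exists>c. F = monomial_sum d c)"

lemma finite_exponents: "finite {e :: 'n::finite \<Rightarrow> nat. sum e UNIV = d}"
proof (rule finite_subset)
  show "{e :: 'n \<Rightarrow> nat. sum e UNIV = d} \<subseteq> PiE UNIV (\<lambda>_. {..d})"
    by (auto simp: PiE_UNIV_domain intro: member_le_sum)
qed (auto intro: finite_PiE)

lemma form_coordinate: "form 1 (\<lambda>v::complex^'n::finite. v $ i)"
proof -
  define u where "u = (\<lambda>j::'n. if j = i then 1 else 0 :: nat)"
  have "v $ i = monomial_sum 1 (\<lambda>e. if e = u then 1 else 0) v" for v :: "complex^'n"
  proof -
    have u: "sum u UNIV = 1" by (simp add: u_def)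
    have "monomial_sum 1 (\<lambda>e. if e = u then 1 else 0) v
        = (\<Sum>e | sum e UNIV = 1. if e = u then \<Prod>j\<in>UNIV. (v $ j) ^ u j else 0)"
      unfolding monomial_sum_def by (intro sum.cong) auto
    also have "\<dots> = (\<Prod>j\<in>UNIV. (v $ j) ^ u j)"
      using u by (simp add: sum.delta finite_exponents)
    also have "\<dots> = (\<Prod>j\<in>UNIV. if j = i then v $ i else 1)"
      by (intro prod.cong) (auto simp: u_def)
    also have "\<dots> = v $ i" by simp
    finally show ?thesis ..
  qed
  thus ?thesis unfolding form_def by blast
qed

lemma form_const: "form 0 (\<lambda>v::complex^'n::finite. a)"
proof -
  have "{e :: 'n \<Rightarrow> nat. sum e UNIV = 0} = {\<lambda>_. 0}" by (auto simp: fun_eq_iff)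
  hence "(\<lambda>v::complex^'n. a) = monomial_sum 0 (\<lambda>_. a)"
    by (simp add: monomial_sum_def fun_eq_iff)
  thus ?thesis unfolding form_def by blast
qed

lemma form_add: "form d F \<Longrightarrow> form d G \<Longrightarrow> form d (\<lambda>v. F v + G v)"
  unfolding form_def monomial_sum_def fun_eq_iff
  by (elim exE, rule_tac x = "\<lambda>e. c e + ca e" in exI) (simp add: distrib_right sum.distrib)

lemma form_mult:
  fixes F G :: "complex^'n::finite \<Rightarrow> complex"
  assumes "form a F" "form b G"
  shows "form (a + b) (\<lambda>v. F v * G v)"
proof -
  obtain c c' where c: "F = monomial_sum a c" "G = monomial_sum b c'"
    using assms by (auto simp: form_def)
  let ?A = "\<lambda>d. {e :: 'n \<Rightarrow> nat. sum e UNIV = d}"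
  let ?m = "\<lambda>e (v::complex^'n). \<Prod>i\<in>UNIV. (v $ i) ^ e i"
  \<comment> \<open>The coefficients of the product: convolution over pairs of exponent vectors.\<close>
  define c2 where "c2 = (\<lambda>e. \<Sum>(f, g) \<in> ?A a \<times> ?A b. if (\<lambda>i. f i + g i) = e then c f * c' g else 0)"
  have "F v * G v = monomial_sum (a + b) c2 v" for v
  proof -
    have "monomial_sum (a + b) c2 v =
        (\<Sum>e\<in>?A (a + b). \<Sum>(f, g) \<in> ?A a \<times> ?A b.
          if (\<lambda>i. f i + g i) = e then c f * c' g * ?m (\<lambda>i. f i + g i) v else 0)"
      unfolding monomial_sum_def c2_def sum_distrib_right
      by (intro sum.cong refl) (auto intro!: sum.cong)
    also have "\<dots> = (\<Sum>(f, g) \<in> ?A a \<times> ?A b. \<Sum>e\<in>?A (a + b).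
          if (\<lambda>i. f i + g i) = e then c f * c' g * ?m (\<lambda>i. f i + g i) v else 0)"
      by (subst sum.swap) (simp add: case_prod_unfold)
    also have "\<dots> = (\<Sum>(f, g) \<in> ?A a \<times> ?A b. c f * c' g * ?m (\<lambda>i. f i + g i) v)"
      by (intro sum.cong refl) (auto simp: sum.delta' finite_exponents sum.distrib)
    also have "\<dots> = (\<Sum>(f, g) \<in> ?A a \<times> ?A b. (c f * ?m f v) * (c' g * ?m g v))"
      by (intro sum.cong refl) (auto simp: power_add prod.distrib)
    also have "\<dots> = F v * G v"
      unfolding c monomial_sum_def sum_product sum.cartesian_product ..
    finally show ?thesis ..
  qed
  thus ?thesis unfolding form_def by blast
qed

lemma form_power: "form d F \<Longrightarrow> form (n * d) (\<lambda>v. F v ^ n)"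
proof (induction n)
  case 0
  show ?case using form_const[of 1] by simp
next
  case (Suc n)
  thus ?case using form_mult[of d F "n * d" "\<lambda>v. F v ^ n"] by simp
qed

lemma form_scale: "form d F \<Longrightarrow> form d (\<lambda>v. a * F v)"
  using form_mult[OF form_const] by fastforce

lemma form_diff: "form d F \<Longrightarrow> form d G \<Longrightarrow> form d (\<lambda>v. F v - G v)"
  using form_add[of d F "\<lambda>v. (-1) * G v"] form_scale[of d G "-1"] by simp

lemma form_S: "form 7 (S \<alpha>)"
proof -
  let ?x = "\<lambda>v::complex^4. v $ 1" and ?y = "\<lambda>v::complex^4. v $ 2"
    and ?z = "\<lambda>v::complex^4. v $ 3" and ?w = "\<lambda>v::complex^4. v $ 4"
  note co = form_coordinate
  have p: "form n (\<lambda>v::complex^4. (v $ i) ^ n)" for n i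
    using form_power[OF co, of n] by simp
  have r: "form 2 (\<lambda>v. ?x v ^ 2 + ?y v ^ 2)" by (intro form_add p)
  have P: "form 7 (\<lambda>v. P (?x v) (?y v) (?z v))"
  proof -
    have "form 6 (\<lambda>v. ?x v ^ 6 - 3 * 7 * ?x v ^ 4 * ?y v ^ 2 + 5 * 7 * ?x v ^ 2 * ?y v ^ 4 - 7 * ?y v ^ 6)"
      using form_mult[OF form_scale[OF p[of 4 1], of "3*7"] p[of 2 2]]
        form_mult[OF form_scale[OF p[of 2 1], of "5*7"] p[of 4 2]]
      by (intro form_add form_diff form_scale p) simp_all
    moreover have "form 6 (\<lambda>v. (?x v ^ 2 + ?y v ^ 2)^3 - 2^3 * ?z v ^ 2 * (?x v ^ 2 + ?y v ^ 2)^2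
        + 2^4 * ?z v ^ 4 * (?x v ^ 2 + ?y v ^ 2))"
      using form_power[OF r, of 3] form_mult[OF form_scale[OF p[of 2 3], of "2^3"] form_power[OF r, of 2]]
        form_mult[OF form_scale[OF p[of 4 3], of "2^4"] r]
      by (intro form_add form_diff) simp_all
    ultimately show ?thesis
      unfolding P_def
      using form_mult[OF co[of 1]] form_mult[OF form_scale[OF co[of 3], of 7]]
      by (intro form_add form_diff form_scale p) force+
  qed
  have "form 3 (\<lambda>v. (?z v + ?w v) * (?x v ^ 2 + ?y v ^ 2))"
    using form_mult[OF form_add[OF co[of 3] co[of 4]] r] by (simp add: numeral_3_eq_3)
  moreover have "form 3 (\<lambda>v. a * ?z v ^ 2 * ?w v)" "form 3 (\<lambda>v. a * ?z v * ?w v ^ 2)" for a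
    using form_mult[OF form_scale[OF p[of 2 3], of a] co[of 4]]
      form_mult[OF form_scale[OF co[of 3], of a] p[of 2 4]]
    by (simp_all add: numeral_3_eq_3)
  ultimately have "form 3 (\<lambda>v. (?z v + ?w v) * (?x v ^ 2 + ?y v ^ 2) + a1 \<alpha> * ?z v ^ 3
      + a2 \<alpha> * ?z v ^ 2 * ?w v + a3 \<alpha> * ?z v * ?w v ^ 2 + a4 \<alpha> * ?w v ^ 3)"
    by (intro form_add form_scale p)
  from form_mult[OF form_add[OF co[of 3] form_scale[OF co[of 4], of "a5 \<alpha>"]] form_power[OF this, of 2]]
  have "form 7 (\<lambda>v. U \<alpha> (?x v) (?y v) (?z v) (?w v))"
    unfolding U_def by simp
  from form_diff[OF P this] show ?thesis
    unfolding S_def .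
qed

lemma homogeneous_form_S: "homogeneous_form 7 (S \<alpha>)"
proof -
  have "S \<alpha> (axis 1 1) = 1" by (simp add: S_def P_def U_def axis_def)
  hence "\<exists>v. S \<alpha> v \<noteq> 0" by (metis zero_neq_one)
  thus ?thesis
    using form_S[of \<alpha>] unfolding homogeneous_form_def form_def monomial_sum_def by blast
qed


section \<open>The 99 nodes\<close>

theorem theorem1:
  shows "(\<forall>\<alpha>::complex. 7 * \<alpha>^3 + 7 * \<alpha> + 1 = 0 \<longrightarrow>
            homogeneous_form 7 (S \<alpha>)
            \<and> card {p. ordinary_double_point (S \<alpha>) p} = 99
            \<and> (\<forall>p. singular_point (S \<alpha>) p \<longrightarrow> ordinary_double_point (S \<alpha>) p))
       \<and> (\<exists>!r::real. 7 * r^3 + 7 * r + 1 = 0)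
       \<and> (\<forall>r::real. 7 * r^3 + 7 * r + 1 = 0 \<longrightarrow>
            \<bar>r - (- 0.14010685)\<bar> \<le> 5 / 10^9
            \<and> (\<forall>p. singular_point (S (complex_of_real r)) p \<longrightarrow> real_point p))"
proof (intro conjI allI impI)
  fix \<alpha> :: complex assume \<alpha>: "7 * \<alpha>^3 + 7 * \<alpha> + 1 = 0"
  show "homogeneous_form 7 (S \<alpha>)" by (rule homogeneous_form_S)
  show sing: "ordinary_double_point (S \<alpha>) p" if "singular_point (S \<alpha>) p" for p
    using that singular_point_iff_node[OF \<alpha>] node_point_ordinary[OF \<alpha>] by auto
  have "{p. ordinary_double_point (S \<alpha>) p} = node_point \<alpha> ` affine_nodes"
    using sing singular_point_iff_node[OF \<alpha>] unfolding ordinary_double_point_def by blast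
  thus "card {p. ordinary_double_point (S \<alpha>) p} = 99"
    using inj_node_point[OF root_nonzero[OF \<alpha>]] card_affine_nodes
    by (simp add: card_image inj_on_subset)
next
  show "\<exists>!r::real. 7 * r^3 + 7 * r + 1 = 0" by (rule unique_real_root)
next
  fix r :: real assume r: "7 * r^3 + 7 * r + 1 = 0"
  show "\<bar>r - (- 0.14010685)\<bar> \<le> 5 / 10^9" using r by (rule root_approx)
  have "7 * (complex_of_real r)^3 + 7 * complex_of_real r + 1 = of_real (7 * r^3 + 7 * r + 1)"
    by simp
  hence \<alpha>: "7 * (complex_of_real r)^3 + 7 * complex_of_real r + 1 = 0" using r by simp
  show "real_point p" if "singular_point (S (complex_of_real r)) p" for p
    using that node_point_real unfolding singular_point_iff_node[OF \<alpha>] by auto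
qed

end
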